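(* Assume the standing hypotheses below. Let $S=R[\lambda,\mu]$ with new indeterminates $\lambda,\mu$, and set $F=f(\lambda^4w,\lambda^3\mu x,\lambda\mu^3y,\mu^4z)=\sum_i f^{(i,4d_1-i)}\lambda^i\mu^{4d_1-i}$, $G=g(\lambda^4w,\lambda^3\mu x,\lambda\mu^3y,\mu^4z)=\sum_j g^{(j,4d_2-j)}\lambda^j\mu^{4d_2-j}$. Let $\tilde F=F/(\lambda^{i_{\min}}\mu^{4d_1-i_{\max}})$ and $\tilde G=G/(\lambda^{j_{\min}}\mu^{4d_2-j_{\max}})$ (i.e. $F,G$ with the largest possible powers of $\lambda$ and $\mu$ divided out). Let $t_{\min}=\gcd(f_{\min},g_{\min})$ and $t_{\max}=\gcd(f_{\max},g_{\max})$ in $R$. Then $$\sqrt{(\tilde F,\tilde G)S}=(\lambda,\mu)S\cap\sqrt{(\lambda,t_{\min})S}\cap\sqrt{(\mu,t_{\max})S}\cap\mathfrak pS.$$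
   Context: Let $k$ be an algebraically closed field of characteristic zero, $R=k[w,x,y,z]$, and let $\mathfrak p\subseteq R$ be the homogeneous prime ideal of Macaulay's curve $C_4\subseteq\mathbb P^3_k$, the curve with parametrization $[s^4:s^3t:st^3:t^4]$. Endow $R$ with the bigrading $\deg w=(4,0)$, $\deg x=(3,1)$, $\deg y=(1,3)$, $\deg z=(0,4)$; $\mathfrak p$ is bihomogeneous. Standing hypothesis: $f,g\in\mathfrak p$ are homogeneous (in the usual grading) of degrees $d_1,d_2$ with $\sqrt{(f,g)R}=\mathfrak p$. Write $f=\sum_{i=i_{\min}}^{i_{\max}} f^{(i,4d_1-i)}$ and $g=\sum_{j=j_{\min}}^{j_{\max}} g^{(j,4d_2-j)}$ as sums of bihomogeneous components, where $f^{(i,4d_1-i)}$ is the component of bidegree $(i,4d_1-i)$ and $i_{\min},i_{\max},j_{\min},j_{\max}$ are chosen so that $f_{\min}:=f^{(i_{\min},4d_1-i_{\min})}$, $f_{\max}:=f^{(i_{\max},4d_1-i_{\max})}$, $g_{\min}:=g^{(j_{\min},4d_2-j_{\min})}$, $g_{\max}:=g^{(j_{\max},4d_2-j_{\max})}$ are all nonzero. *)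

theory Defs
  imports "HOL-Library.Poly_Mapping" "HOL-Computational_Algebra.Polynomial"
begin

text \<open>Variables: W X Y Z are w x y z of R = k[w,x,y,z]; L, M are the new
  indeterminates lambda, mu of S = R[lambda,mu].\<close>
datatype var = W | X | Y | Z | L | M

fun var_rank :: "var \<Rightarrow> nat" where
  "var_rank W = 0" | "var_rank X = 1" | "var_rank Y = 2" | "var_rank Z = 3"
| "var_rank L = 4" | "var_rank M = 5"

lemma var_rank_inj: "inj var_rank"
  by (rule injI) (case_tac x; case_tac y; simp)

instantiation var :: linorder
begin
definition less_eq_var :: "var \<Rightarrow> var \<Rightarrow> bool" where
  "less_eq_var a b \<longleftrightarrow> var_rank a \<le> var_rank b"
definition less_var :: "var \<Rightarrow> var \<Rightarrow> bool" where
  "less_var a b \<longleftrightarrow> var_rank a < var_rank b"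
instance
  by standard (auto simp: less_eq_var_def less_var_def dest: injD[OF var_rank_inj])
end

text \<open>Multivariate polynomials over k in the variables var (the ring S);
  R is the subring of polynomials involving only W X Y Z.\<close>
type_synonym 'k mpoly = "(var \<Rightarrow>\<^sub>0 nat) \<Rightarrow>\<^sub>0 'k"

definition Var :: "var \<Rightarrow> 'k::{zero,one} mpoly" where
  "Var v = Poly_Mapping.single (Poly_Mapping.single v 1) 1"

definition Const :: "'k::zero \<Rightarrow> 'k mpoly" where
  "Const c = Poly_Mapping.single 0 c"

definition vars :: "'k::zero mpoly \<Rightarrow> var set" where
  "vars p = (\<Union>m\<in>Poly_Mapping.keys p. Poly_Mapping.keys m)"

definition Rring :: "'k::zero mpoly set" where
  "Rring = {p. vars p \<subseteq> {W, X, Y, Z}}"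

definition peval :: "('k::zero \<Rightarrow> 'b::comm_ring_1) \<Rightarrow> (var \<Rightarrow> 'b) \<Rightarrow> 'k mpoly \<Rightarrow> 'b" where
  "peval c \<sigma> p = (\<Sum>m\<in>Poly_Mapping.keys p. c (Poly_Mapping.lookup p m) * (\<Prod>v\<in>Poly_Mapping.keys m. \<sigma> v ^ Poly_Mapping.lookup m v))"

definition mdeg :: "(var \<Rightarrow>\<^sub>0 nat) \<Rightarrow> nat" where
  "mdeg m = (\<Sum>v\<in>Poly_Mapping.keys m. Poly_Mapping.lookup m v)"

definition homogeneous :: "'k::zero mpoly \<Rightarrow> nat \<Rightarrow> bool" where
  "homogeneous p d \<longleftrightarrow> (\<forall>m\<in>Poly_Mapping.keys p. mdeg m = d)"

text \<open>First coordinate of the bidegree: deg w = (4,0), deg x = (3,1),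
  deg y = (1,3), deg z = (0,4).  For a monomial of standard degree d the
  bidegree is (i, 4d - i) with i this number.\<close>
definition bideg1 :: "(var \<Rightarrow>\<^sub>0 nat) \<Rightarrow> nat" where
  "bideg1 m = 4 * Poly_Mapping.lookup m W + 3 * Poly_Mapping.lookup m X + Poly_Mapping.lookup m Y"

text \<open>Bihomogeneous component of bidegree (i, 4d - i) of a polynomial in R
  that is homogeneous of degree d.\<close>
definition bicomp :: "'k::comm_monoid_add mpoly \<Rightarrow> nat \<Rightarrow> 'k mpoly" where
  "bicomp p i = (\<Sum>m\<in>{m\<in>Poly_Mapping.keys p. bideg1 m = i}. Poly_Mapping.single m (Poly_Mapping.lookup p m))"

definition imin :: "'k::zero mpoly \<Rightarrow> nat" where
  "imin p = Min (bideg1 ` Poly_Mapping.keys p)"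

definition imax :: "'k::zero mpoly \<Rightarrow> nat" where
  "imax p = Max (bideg1 ` Poly_Mapping.keys p)"

definition ideal_in :: "'a::comm_ring_1 set \<Rightarrow> 'a set \<Rightarrow> 'a set" where
  "ideal_in Rs A = {x. \<exists>B c. finite B \<and> B \<subseteq> A \<and> (\<forall>a\<in>B. c a \<in> Rs)
                          \<and> x = (\<Sum>a\<in>B. c a * a)}"

definition radical_in :: "'a::comm_ring_1 set \<Rightarrow> 'a set \<Rightarrow> 'a set" where
  "radical_in Rs I = {x\<in>Rs. \<exists>n. x ^ n \<in> I}"

definition dvd_in :: "'a::comm_ring_1 set \<Rightarrow> 'a \<Rightarrow> 'a \<Rightarrow> bool" where
  "dvd_in Rs a b \<longleftrightarrow> (\<exists>q\<in>Rs. b = a * q)"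

definition is_gcd_in :: "'a::comm_ring_1 set \<Rightarrow> 'a \<Rightarrow> 'a \<Rightarrow> 'a \<Rightarrow> bool" where
  "is_gcd_in Rs t a b \<longleftrightarrow> t \<in> Rs \<and> dvd_in Rs t a \<and> dvd_in Rs t b
     \<and> (\<forall>c\<in>Rs. dvd_in Rs c a \<and> dvd_in Rs c b \<longrightarrow> dvd_in Rs c t)"

text \<open>Homogeneous ideal of Macaulay's curve C4 = image of [s^4:s^3t:st^3:t^4]:
  polynomials of R vanishing on all points of the (affine cone over the) curve.\<close>
definition C4_ideal :: "'k::comm_ring_1 mpoly set" where
  "C4_ideal = {f\<in>Rring. \<forall>s t::'k. peval id
      (\<lambda>v. case v of W \<Rightarrow> s^4 | X \<Rightarrow> s^3 * t | Y \<Rightarrow> s * t^3 | Z \<Rightarrow> t^4 | _ \<Rightarrow> 0) f = 0}"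

definition alg_closed :: "'k::field itself \<Rightarrow> bool" where
  "alg_closed _ \<longleftrightarrow> (\<forall>q::'k poly. Polynomial.degree q > 0 \<longrightarrow> (\<exists>x. poly q x = 0))"

definition bisubst :: "var \<Rightarrow> 'k::comm_ring_1 mpoly" where
  "bisubst v = (case v of
      W \<Rightarrow> Var L ^ 4 * Var W
    | X \<Rightarrow> Var L ^ 3 * Var M * Var X
    | Y \<Rightarrow> Var L * Var M ^ 3 * Var Y
    | Z \<Rightarrow> Var M ^ 4 * Var Z
    | L \<Rightarrow> Var L
    | M \<Rightarrow> Var M)"

end

theory Submission
  imports Defs "Berlekamp_Zassenhaus.Unique_Factorization_Poly" "Subresultants.Resultant_Prelim"
begin

text \<open>
  Write \<open>I\<close> for the ideal of \<open>Ft, Gt\<close>. If \<open>x\<close> is bihomogeneous in the ideal \<open>p\<close> of the curve,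
  a power of \<open>x\<close> is a combination of \<open>f, g\<close>, and applying the substitution shows
  \<open>\<lambda> \<mu> x \<in> \<surd>I\<close>. Modulo \<open>\<lambda>\<close>, the generators of \<open>I\<close> are \<open>t\<^sub>m\<^sub>i\<^sub>n\<close> times powers of \<open>\<mu>\<close> times coprime
  elements of the factorial ring \<open>R\<close>, so their syzygies are Koszul and lift; hence
  \<open>\<lambda> r \<in> I\<close> implies \<open>\<mu>\<^sup>e t\<^sub>m\<^sub>i\<^sub>n r \<in> I\<close>, which gives \<open>\<mu> t\<^sub>m\<^sub>i\<^sub>n p \<subseteq> \<surd>I\<close>, and symmetrically
  \<open>\<lambda> t\<^sub>m\<^sub>a\<^sub>x p \<subseteq> \<surd>I\<close>. An element of the intersection on the right therefore lies in \<open>\<surd>I\<close>.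

  The other inclusion needs that neither \<open>f\<close> nor \<open>g\<close> is bihomogeneous, and here characteristic
  zero is used. If \<open>f\<close> were bihomogeneous, pass to a prime factor \<open>f\<^sub>1\<close> vanishing at \<open>(1,1,1,1)\<close>;
  modulo \<open>f\<^sub>1\<close>, a factor of a bihomogeneous element is bihomogeneous, so \<open>g\<close> may be replaced by
  one of its components \<open>g'\<close>. Up to order, \<open>f\<^sub>1 = x\<^sup>a + \<dots>\<close> and \<open>g' = y\<^sup>b + \<dots>\<close>, and the bidegree
  forces \<open>f\<^sub>1 \<equiv> x\<^sup>a\<close> modulo \<open>w\<^sup>2\<close>. Restricted to the points \<open>(w, x, 1/x, 1)\<close> both become
  polynomials in \<open>w\<close> and \<open>\<xi> = x\<^sup>4\<close> whose common zeros all have \<open>w = 1\<close>, because \<open>x y = w z\<close>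
  on the curve. Their resultant with respect to \<open>\<xi>\<close> is thus a power of \<open>w - 1\<close> up to a constant,
  yet constant modulo \<open>w\<^sup>2\<close>, so it is constant, contradicting the common zero \<open>(1,1)\<close>.
\<close>

section \<open>Evaluation and gradings\<close>

lemma UNIV_var: "UNIV = {W, X, Y, Z, L, M}"
  by (auto intro: var.exhaust)

instance var :: finite
  by standard (simp add: UNIV_var)

text \<open>The product runs over all six variables, whereas \<open>peval\<close> uses only the
  support of the monomial; the additional factors are zeroth powers, and multiplicativity in
  \<open>m\<close> becomes immediate.\<close>

definition mon_eval :: "(var \<Rightarrow> 'b::comm_ring_1) \<Rightarrow> (var \<Rightarrow>\<^sub>0 nat) \<Rightarrow> 'b" where
  "mon_eval \<sigma> m = (\<Prod>v\<in>UNIV. \<sigma> v ^ Poly_Mapping.lookup m v)"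

lemma mon_eval_keys:
  "(\<Prod>v\<in>Poly_Mapping.keys m. \<sigma> v ^ Poly_Mapping.lookup m v) = mon_eval \<sigma> m"
  unfolding mon_eval_def
  by (rule prod.mono_neutral_left) (auto simp: in_keys_iff)

lemma mon_eval_0 [simp]: "mon_eval \<sigma> 0 = 1"
  by (simp add: mon_eval_def)

lemma mon_eval_add: "mon_eval \<sigma> (m + n) = mon_eval \<sigma> m * mon_eval \<sigma> n"
  by (simp add: mon_eval_def lookup_add power_add prod.distrib)

lemma mon_eval_single [simp]: "mon_eval \<sigma> (Poly_Mapping.single v n) = \<sigma> v ^ n"
proof -
  have "mon_eval \<sigma> (Poly_Mapping.single v n) = (\<Prod>u\<in>UNIV. if u = v then \<sigma> v ^ n else 1)"
    unfolding mon_eval_def by (rule prod.cong) (auto simp: lookup_single)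
  then show ?thesis by simp
qed

lemma peval_superset:
  assumes "finite A" "Poly_Mapping.keys p \<subseteq> A" "c 0 = 0"
  shows "peval c \<sigma> p = (\<Sum>m\<in>A. c (Poly_Mapping.lookup p m) * mon_eval \<sigma> m)"
  unfolding peval_def mon_eval_keys
  using assms by (intro sum.mono_neutral_left) (auto simp: in_keys_iff)

lemma poly_mapping_sum_single:
  "(\<Sum>m\<in>Poly_Mapping.keys p. Poly_Mapping.single m (Poly_Mapping.lookup p m)) = p"
  by (rule poly_mapping_eqI)
     (auto simp: lookup_sum lookup_single when_def in_keys_iff sum.delta if_distrib cong: if_cong)

lemma peval_single:
  assumes "c 0 = 0"
  shows "peval c \<sigma> (Poly_Mapping.single m a) = c a * mon_eval \<sigma> m"
  by (subst peval_superset[of "{m}"]) (use assms in auto)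

lemma peval_add:
  assumes "comm_ring_hom c"
  shows "peval c \<sigma> (p + q) = peval c \<sigma> p + peval c \<sigma> q"
proof -
  interpret comm_ring_hom c by fact
  let ?A = "Poly_Mapping.keys p \<union> Poly_Mapping.keys q"
  have "Poly_Mapping.keys (p + q) \<subseteq> ?A" by (rule keys_add)
  then show ?thesis
    by (subst (1 2 3) peval_superset[of ?A]) (auto simp: lookup_add hom_add algebra_simps sum.distrib)
qed

lemma peval_0 [simp]: "peval c \<sigma> 0 = 0"
  by (simp add: peval_def)

lemma peval_sum:
  assumes "comm_ring_hom c"
  shows "peval c \<sigma> (\<Sum>i\<in>A. p i) = (\<Sum>i\<in>A. peval c \<sigma> (p i))"
  by (induction A rule: infinite_finite_induct) (auto simp: peval_add[OF assms])

lemma peval_mult: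
  assumes "comm_ring_hom c"
  shows "peval c \<sigma> (p * q) = peval c \<sigma> p * peval c \<sigma> q"
proof -
  interpret comm_ring_hom c by fact
  let ?s = "\<lambda>p m. Poly_Mapping.single m (Poly_Mapping.lookup p m)"
  have "peval c \<sigma> (p * q) =
      peval c \<sigma> ((\<Sum>m\<in>Poly_Mapping.keys p. ?s p m) * (\<Sum>n\<in>Poly_Mapping.keys q. ?s q n))"
    by (simp only: poly_mapping_sum_single)
  also have "\<dots> = (\<Sum>m\<in>Poly_Mapping.keys p. \<Sum>n\<in>Poly_Mapping.keys q.
      peval c \<sigma> (?s p m * ?s q n))"
    by (simp only: sum_product peval_sum[OF assms])
  also have "\<dots> = (\<Sum>m\<in>Poly_Mapping.keys p. \<Sum>n\<in>Poly_Mapping.keys q.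
      peval c \<sigma> (?s p m) * peval c \<sigma> (?s q n))"
    by (intro sum.cong refl) (simp add: mult_single peval_single hom_mult mon_eval_add)
  also have "\<dots> = (\<Sum>m\<in>Poly_Mapping.keys p. peval c \<sigma> (?s p m))
      * (\<Sum>n\<in>Poly_Mapping.keys q. peval c \<sigma> (?s q n))"
    by (simp only: sum_product)
  also have "\<dots> = peval c \<sigma> p * peval c \<sigma> q"
    by (simp only: peval_sum[OF assms, symmetric] poly_mapping_sum_single)
  finally show ?thesis .
qed

lemma Const_0 [simp]: "Const 0 = 0"
  by (simp add: Const_def)

lemma Const_1 [simp]: "Const 1 = 1"
  by (simp add: Const_def)

lemma comm_ring_hom_Const: "comm_ring_hom (Const :: 'a::comm_ring_1 \<Rightarrow> _)"
  by standard (auto simp: Const_def single_add mult_single)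

lemma peval_Const:
  assumes "comm_ring_hom c"
  shows "peval c \<sigma> (Const a) = c a"
proof -
  interpret comm_ring_hom c by fact
  show ?thesis by (simp add: Const_def peval_single)
qed

lemma peval_Var [simp]:
  assumes "comm_ring_hom c"
  shows "peval c \<sigma> (Var v) = \<sigma> v"
proof -
  interpret comm_ring_hom c by fact
  show ?thesis by (simp add: Var_def peval_single)
qed

lemma comm_ring_hom_peval:
  assumes "comm_ring_hom c"
  shows "comm_ring_hom (peval c \<sigma>)"
proof -
  interpret comm_ring_hom c by fact
  show ?thesis
    by standard (auto simp: peval_add[OF assms] peval_mult[OF assms]
        peval_single single_one[symmetric] simp del: single_one)
qed

lemma comm_ring_hom_id: "comm_ring_hom (id :: 'a::comm_ring_1 \<Rightarrow> 'a)"
  by standard auto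

lemma comm_ring_hom_ident: "comm_ring_hom (\<lambda>a::'a::comm_ring_1. a)"
  by standard auto

lemma Var_power: "Var v ^ n = Poly_Mapping.single (Poly_Mapping.single v n) (1::'a::comm_ring_1)"
  by (induction n) (auto simp: Var_def mult_single single_add[symmetric])

lemma mon_eval_Var: "mon_eval Var m = (Poly_Mapping.single m 1 :: 'a::comm_ring_1 mpoly)"
proof -
  have *: "(\<Prod>v\<in>A. Poly_Mapping.single (Poly_Mapping.single v (Poly_Mapping.lookup m v)) 1)
      = (Poly_Mapping.single (\<Sum>v\<in>A. Poly_Mapping.single v (Poly_Mapping.lookup m v)) 1 :: 'a mpoly)"
    if "finite A" for A :: "var set"
    using that by induction (auto simp: mult_single)
  have "(\<Sum>v\<in>UNIV. Poly_Mapping.single v (Poly_Mapping.lookup m v)) = m"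
    by (rule poly_mapping_eqI) (auto simp: lookup_sum lookup_single when_def)
  with *[of UNIV] show ?thesis by (simp add: mon_eval_def Var_power)
qed

lemma single_eq_Const_mult:
  "Poly_Mapping.single m a = Const a * mon_eval Var (m :: var \<Rightarrow>\<^sub>0 nat)" for a :: "'a::comm_ring_1"
  by (simp add: mon_eval_Var Const_def mult_single)

lemma (in comm_ring_hom) hom_mon_eval: "hom (mon_eval \<sigma> m) = mon_eval (\<lambda>v. hom (\<sigma> v)) m"
  by (simp add: mon_eval_def hom_prod hom_power)

lemma hom_eq_peval:
  fixes h :: "'a::comm_ring_1 mpoly \<Rightarrow> 'b::comm_ring_1"
  assumes "comm_ring_hom h"
  shows "h p = peval (\<lambda>a. h (Const a)) (\<lambda>v. h (Var v)) p"
proof -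
  interpret comm_ring_hom h by fact
  have "h p = h (\<Sum>m\<in>Poly_Mapping.keys p. Const (Poly_Mapping.lookup p m) * mon_eval Var m)"
    by (simp only: single_eq_Const_mult[symmetric] poly_mapping_sum_single)
  also have "\<dots> = peval (\<lambda>a. h (Const a)) (\<lambda>v. h (Var v)) p"
    by (simp add: hom_sum hom_mult hom_mon_eval peval_def mon_eval_keys)
  finally show ?thesis .
qed

text \<open>Constants and variables generate the ring, so an identity between two homomorphisms need
  only be checked there; identities about gradings and changes of ring are obtained this
  way.\<close>

lemma hom_eqI:
  fixes h1 h2 :: "'a::comm_ring_1 mpoly \<Rightarrow> 'b::comm_ring_1"
  assumes "comm_ring_hom h1" "comm_ring_hom h2"
    and "\<And>a. h1 (Const a) = h2 (Const a)" "\<And>v. h1 (Var v) = h2 (Var v)"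
  shows "h1 p = h2 p"
  using hom_eq_peval[OF assms(1), of p] hom_eq_peval[OF assms(2), of p] assms(3,4) by simp

lemma comm_ring_hom_comp:
  assumes "comm_ring_hom f" "comm_ring_hom g"
  shows "comm_ring_hom (\<lambda>x. g (f x))"
proof -
  interpret f: comm_ring_hom f by fact
  interpret g: comm_ring_hom g by fact
  show ?thesis by standard (auto simp: f.hom_add g.hom_add f.hom_mult g.hom_mult)
qed

section \<open>Weighted gradings, encoded in an auxiliary univariate polynomial ring\<close>

definition wdeg :: "(var \<Rightarrow> nat) \<Rightarrow> (var \<Rightarrow>\<^sub>0 nat) \<Rightarrow> nat" where
  "wdeg \<omega> m = (\<Sum>v\<in>UNIV. \<omega> v * Poly_Mapping.lookup m v)"

text \<open>The homomorphism that multiplies each variable \<open>v\<close> by the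
  \<open>\<omega> v\<close>-th power of a new indeterminate T. The coefficient of T^i is the
  component of weight \<open>i\<close>, so products of components become products of univariate
  polynomials.\<close>

definition graded :: "(var \<Rightarrow> nat) \<Rightarrow> 'a::comm_ring_1 mpoly \<Rightarrow> 'a mpoly poly" where
  "graded \<omega> = peval (\<lambda>c. [:Const c:]) (\<lambda>v. monom (Var v) (\<omega> v))"

definition whom :: "(var \<Rightarrow> nat) \<Rightarrow> 'a::zero mpoly \<Rightarrow> nat \<Rightarrow> bool" where
  "whom \<omega> p d \<longleftrightarrow> (\<forall>m\<in>Poly_Mapping.keys p. wdeg \<omega> m = d)"

lemma comm_ring_hom_const_Const: "comm_ring_hom (\<lambda>c::'a::comm_ring_1. [:Const c:])"
  by (rule comm_ring_hom_comp[OF comm_ring_hom_Const]) (standard, auto)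

lemma comm_ring_hom_graded: "comm_ring_hom (graded \<omega> :: 'a::comm_ring_1 mpoly \<Rightarrow> _)"
  unfolding graded_def by (rule comm_ring_hom_peval[OF comm_ring_hom_const_Const])

lemma graded_Const: "graded \<omega> (Const c) = [:Const c:]"
  by (simp add: graded_def peval_Const comm_ring_hom_const_Const)

lemma graded_Var: "graded \<omega> (Var v) = monom (Var v) (\<omega> v)"
  by (simp add: graded_def comm_ring_hom_const_Const)

lemma mon_eval_monom: "mon_eval (\<lambda>v. monom (\<sigma> v) (\<omega> v)) m = monom (mon_eval \<sigma> m) (wdeg \<omega> m)"
proof -
  have "(\<Prod>v\<in>A. monom (\<sigma> v) (\<omega> v) ^ Poly_Mapping.lookup m v)
     = monom (\<Prod>v\<in>A. \<sigma> v ^ Poly_Mapping.lookup m v) (\<Sum>v\<in>A. \<omega> v * Poly_Mapping.lookup m v)"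
    if "finite A" for A
    using that by induction (auto simp: monom_power mult_monom mult.commute)
  then show ?thesis by (simp add: mon_eval_def wdeg_def)
qed

lemma graded_eq_sum:
  "graded \<omega> p = (\<Sum>m\<in>Poly_Mapping.keys p.
      monom (Poly_Mapping.single m (Poly_Mapping.lookup p m)) (wdeg \<omega> m))"
  unfolding graded_def peval_def mon_eval_keys mon_eval_monom
  by (intro sum.cong refl) (simp add: single_eq_Const_mult smult_monom)

lemma coeff_graded:
  "coeff (graded \<omega> p) i = (\<Sum>m\<in>{m\<in>Poly_Mapping.keys p. wdeg \<omega> m = i}.
     Poly_Mapping.single m (Poly_Mapping.lookup p m))"
  unfolding graded_eq_sum coeff_sum
  by (simp add: sum.inter_filter[symmetric] sum.inter_restrict)

lemma lookup_coeff_graded: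
  "Poly_Mapping.lookup (coeff (graded \<omega> p) i) m = (if wdeg \<omega> m = i then Poly_Mapping.lookup p m else 0)"
  by (auto simp: coeff_graded lookup_sum lookup_single when_def in_keys_iff)

lemma keys_coeff_graded:
  "Poly_Mapping.keys (coeff (graded \<omega> p) i) = {m\<in>Poly_Mapping.keys p. wdeg \<omega> m = i}"
  by (auto simp: in_keys_iff lookup_coeff_graded split: if_splits)

lemma whom_coeff_graded: "whom \<omega> (coeff (graded \<omega> p) i) i"
  by (simp add: whom_def keys_coeff_graded)

lemma whom_iff_graded: "whom \<omega> p d \<longleftrightarrow> graded \<omega> p = monom p d"
proof
  assume "whom \<omega> p d"
  then have "graded \<omega> p = monom (\<Sum>m\<in>Poly_Mapping.keys p. Poly_Mapping.single m (Poly_Mapping.lookup p m)) d"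
    by (simp add: graded_eq_sum whom_def monom_hom.hom_sum)
  then show "graded \<omega> p = monom p d" by (simp only: poly_mapping_sum_single)
next
  assume "graded \<omega> p = monom p d"
  with whom_coeff_graded[of \<omega> p d] show "whom \<omega> p d" by simp
qed

lemma sum_coeff_graded:
  fixes p :: "'a::comm_ring_1 mpoly"
  shows "(\<Sum>i\<le>degree (graded \<omega> p). coeff (graded \<omega> p) i) = p"
proof -
  have "comm_ring_hom (\<lambda>p::'a mpoly. poly (graded \<omega> p) 1)"
    by (rule comm_ring_hom_comp[OF comm_ring_hom_graded]) (standard, auto)
  then have "(\<lambda>p. poly (graded \<omega> p) 1) p = (\<lambda>p. p) p"
    by (rule hom_eqI[OF _ comm_ring_hom_ident]) (auto simp: graded_Const graded_Var poly_monom)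
  then show ?thesis by (simp add: poly_altdef)
qed

text \<open>In a domain the product of the lowest terms and the product of the leading terms of
  \<open>p\<close> and \<open>q\<close> are both nonzero. Both must sit in degree \<open>d\<close>,
  which leaves \<open>p\<close> only one term.\<close>

lemma monom_factor:
  fixes p q :: "'a::idom poly"
  assumes "p * q = monom c d" "c \<noteq> 0"
  obtains e where "p = monom (coeff p e) e"
proof -
  define i where "i = (LEAST i. coeff p i \<noteq> 0)"
  define j where "j = (LEAST i. coeff q i \<noteq> 0)"
  have nz: "p \<noteq> 0" "q \<noteq> 0" using assms by (auto simp: monom_eq_0_iff[symmetric] simp del: monom_eq_0_iff)
  have ci: "coeff p i \<noteq> 0" unfolding i_def by (rule LeastI[of _ "degree p"]) (use nz in auto)
  have cj: "coeff q j \<noteq> 0" unfolding j_def by (rule LeastI[of _ "degree q"]) (use nz in auto)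
  have li: "coeff p k = 0" if "k < i" for k using not_less_Least[OF that[unfolded i_def]] by simp
  have lj: "coeff q k = 0" if "k < j" for k using not_less_Least[OF that[unfolded j_def]] by simp
  have "coeff (p * q) (i + j) = (\<Sum>k\<le>i+j. if k = i then coeff p i * coeff q j else 0)"
    unfolding coeff_mult
  proof (rule sum.cong, rule refl)
    fix k assume "k \<in> {..i+j}"
    then consider "k < i" | "k = i" | "i + j - k < j" by fastforce
    then show "coeff p k * coeff q (i + j - k) = (if k = i then coeff p i * coeff q j else 0)"
      by cases (auto simp: li lj)
  qed
  then have "coeff (p * q) (i + j) \<noteq> 0" using ci cj by simp
  then have "i + j = d" by (auto simp: assms split: if_splits)
  moreover have "degree p + degree q = d"
    using degree_mult_eq[OF nz] assms by (simp add: degree_monom_eq)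
  moreover have "i \<le> degree p" "j \<le> degree q" using ci cj by (auto intro: le_degree)
  ultimately have "i = degree p" by simp
  then have "p = monom (coeff p i) i"
    by (intro poly_eqI) (metis coeff_eq_0 coeff_monom li linorder_neqE_nat)
  then show ?thesis by (rule that)
qed

lemma whom_factor:
  fixes p q :: "'a::idom mpoly"
  assumes "whom \<omega> (p * q) d" "p * q \<noteq> 0"
  obtains e where "whom \<omega> p e"
proof -
  interpret comm_ring_hom "graded \<omega> :: 'a mpoly \<Rightarrow> _" by (rule comm_ring_hom_graded)
  have "graded \<omega> p * graded \<omega> q = monom (p * q) d"
    using assms by (simp add: whom_iff_graded hom_mult)
  then obtain e where e: "graded \<omega> p = monom (coeff (graded \<omega> p) e) e"
    using monom_factor assms(2) by blast
  have "wdeg \<omega> m = e" if m: "m \<in> Poly_Mapping.keys p" for m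
  proof (rule ccontr)
    assume "wdeg \<omega> m \<noteq> e"
    then have "coeff (graded \<omega> p) (wdeg \<omega> m) = 0" by (subst e) simp
    moreover have "m \<in> Poly_Mapping.keys (coeff (graded \<omega> p) (wdeg \<omega> m))"
      using m by (simp add: keys_coeff_graded)
    ultimately show False by simp
  qed
  then show ?thesis using that by (auto simp: whom_def)
qed

lemma map_poly_const: "h 0 = 0 \<Longrightarrow> map_poly h [:a:] = [:h a:]"
  by (rule poly_eqI) (auto simp: coeff_map_poly coeff_pCons split: nat.split)

lemma peval_scaled:
  fixes p :: "'a::comm_ring_1 mpoly"
  shows "peval id (\<lambda>v. c ^ \<omega> v * \<sigma> v) p = poly (map_poly (peval id \<sigma>) (graded \<omega> p)) c"
proof (rule hom_eqI)
  interpret comm_ring_hom "peval id \<sigma> :: 'a mpoly \<Rightarrow> 'a" by (rule comm_ring_hom_peval[OF comm_ring_hom_id])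
  interpret mp: map_poly_comm_ring_hom "peval id \<sigma> :: 'a mpoly \<Rightarrow> 'a" ..
  show "comm_ring_hom (\<lambda>p::'a mpoly. poly (map_poly (peval id \<sigma>) (graded \<omega> p)) c)"
    by (rule comm_ring_hom_comp[OF comm_ring_hom_comp[OF comm_ring_hom_graded mp.comm_ring_hom_axioms]])
       (standard, auto)
qed (auto simp: comm_ring_hom_peval comm_ring_hom_ident peval_Const graded_Const graded_Var mult.commute
      map_poly_const map_poly_monom poly_monom)

text \<open>By \<open>peval_scaled\<close> the values at the scaled points form a polynomial in
  \<open>c\<close> whose coefficients are the values of the components at \<open>\<sigma>\<close>.
  It vanishes on an infinite field, hence identically.\<close>

lemma peval_component_eq_0:
  fixes p :: "'a::field_char_0 mpoly"
  assumes "\<And>c. peval id (\<lambda>v. c ^ \<omega> v * \<sigma> v) p = 0"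
  shows "peval id \<sigma> (coeff (graded \<omega> p) i) = 0"
proof -
  have "map_poly (peval id \<sigma>) (graded \<omega> p) = 0"
    using assms unfolding peval_scaled poly_all_0_iff_0[symmetric] by blast
  then show ?thesis by (metis coeff_0 coeff_map_poly peval_0)
qed

section \<open>Resultants\<close>

lemma prod_diff_dvd:
  fixes a b :: "'i \<Rightarrow> 'a::comm_ring_1"
  assumes "\<And>i. i \<in> A \<Longrightarrow> c dvd a i - b i"
  shows "c dvd (\<Prod>i\<in>A. a i) - (\<Prod>i\<in>A. b i)"
  using assms
proof (induction A rule: infinite_finite_induct)
  case (insert i A)
  have "(\<Prod>i\<in>insert i A. a i) - (\<Prod>i\<in>insert i A. b i)
      = a i * (prod a A - prod b A) + (a i - b i) * prod b A"
    using insert.hyps by (simp add: algebra_simps)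
  with insert show ?case by auto
qed auto

lemma det_diff_dvd:
  fixes A B :: "'a::comm_ring_1 mat"
  assumes A: "A \<in> carrier_mat n n" and B: "B \<in> carrier_mat n n"
    and dvd: "\<And>i j. i < n \<Longrightarrow> j < n \<Longrightarrow> c dvd A $$ (i, j) - B $$ (i, j)"
  shows "c dvd det A - det B"
proof -
  have "det A - det B = (\<Sum>p | p permutes {0..<n}.
     signof p * ((\<Prod>i = 0..<n. A $$ (i, p i)) - (\<Prod>i = 0..<n. B $$ (i, p i))))"
    using A B by (simp add: det_def right_diff_distrib sum_subtractf)
  also have "c dvd \<dots>"
  proof (rule dvd_sum, rule dvd_mult, rule prod_diff_dvd)
    fix p i assume "p \<in> {p. p permutes {0..<n}}" and i: "i \<in> {0..<n}"
    then have "p i < n" using permutes_in_image[of p "{0..<n}" i] by simp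
    with i show "c dvd A $$ (i, p i) - B $$ (i, p i)" by (intro dvd) auto
  qed
  finally show ?thesis .
qed

text \<open>The polynomial whose coefficients, from degree \<open>m + n - 1\<close> downwards, make
  up row \<open>i\<close> of the Sylvester matrix: a shift of \<open>p\<close> in the first
  \<open>n\<close> rows, a shift of \<open>q\<close> in the others.\<close>

definition sylv_row :: "nat \<Rightarrow> nat \<Rightarrow> 'a::comm_ring_1 poly \<Rightarrow> 'a poly \<Rightarrow> nat \<Rightarrow> 'a poly" where
  "sylv_row m n p q i = (if i < n then monom 1 (n - 1 - i) * p else monom 1 (m + n - 1 - i) * q)"

lemma sylvester_mat_sub_index_row:
  assumes "degree p \<le> m" "degree q \<le> n" "i < m + n" "j < m + n"
  shows "sylvester_mat_sub m n p q $$ (i, j) = coeff (sylv_row m n p q i) (m + n - 1 - j)"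
proof (cases "i < n")
  case True
  show ?thesis
  proof (cases "i \<le> j \<and> j - i \<le> m")
    case True
    then have "m + n - 1 - j - (n - 1 - i) = m + i - j" "n - 1 - i \<le> m + n - 1 - j"
      using assms \<open>i < n\<close> by auto
    then show ?thesis using True \<open>i < n\<close> assms
      by (simp add: sylvester_mat_sub_index sylv_row_def coeff_monom_mult)
  next
    case False
    then consider "j < i" | "j > m + i" by fastforce
    then show ?thesis
    proof cases
      case 1
      then have "m + n - 1 - j - (n - 1 - i) > m" using \<open>i < n\<close> assms by auto
      then have "coeff p (m + n - 1 - j - (n - 1 - i)) = 0" using assms by (intro coeff_eq_0) auto
      then show ?thesis using 1 \<open>i < n\<close> assms
        by (simp add: sylvester_mat_sub_index sylv_row_def coeff_monom_mult)
    next
      case 2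
      then have "\<not> n - 1 - i \<le> m + n - 1 - j" using \<open>i < n\<close> assms by auto
      then show ?thesis using 2 \<open>i < n\<close> assms
        by (auto simp: sylvester_mat_sub_index sylv_row_def coeff_monom_mult)
    qed
  qed
next
  case False
  show ?thesis
  proof (cases "i - n \<le> j \<and> j \<le> i")
    case True
    then have "m + n - 1 - j - (m + n - 1 - i) = i - j" using assms by auto
    then show ?thesis using True False assms
      by (auto simp: sylvester_mat_sub_index sylv_row_def coeff_monom_mult)
  next
    case nb: False
    then consider "j > i" | "j < i - n" by fastforce
    then show ?thesis
    proof cases
      case 1
      then have "\<not> m + n - 1 - i \<le> m + n - 1 - j" using assms by auto
      then show ?thesis using 1 False assms
        by (auto simp: sylvester_mat_sub_index sylv_row_def coeff_monom_mult)
    next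
      case 2
      then have "m + n - 1 - j - (m + n - 1 - i) > n" using assms by auto
      then have "coeff q (m + n - 1 - j - (m + n - 1 - i)) = 0" using assms by (intro coeff_eq_0) auto
      then show ?thesis using 2 False assms
        by (simp add: sylvester_mat_sub_index sylv_row_def coeff_monom_mult)
    qed
  qed
qed

lemma degree_sylv_row:
  assumes "degree p \<le> m" "degree q \<le> n" "i < m + n"
  shows "degree (sylv_row m n p q i) < m + n"
proof -
  have "degree (monom 1 k * r) \<le> k + degree r" for k and r :: "'a poly"
    by (metis degree_mult_le degree_monom_le add_right_mono order_trans)
  from this[of "n - 1 - i" p] this[of "m + n - 1 - i" q] show ?thesis
    using assms by (auto simp: sylv_row_def)
qed

text \<open>The vector of descending powers of \<open>x\<close> lies in the kernel of the Sylvester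
  matrix, since a row applied to it evaluates a multiple of \<open>p\<close> or \<open>q\<close> at
  \<open>x\<close>. Its last entry is 1, so it is nonzero.\<close>

lemma resultant_sub_eq_0_if_common_root:
  fixes p q :: "'a::field poly"
  assumes dp: "degree p \<le> m" and dq: "degree q \<le> n" and pos: "0 < m + n"
    and "poly p x = 0" "poly q x = 0"
  shows "resultant_sub m n p q = 0"
proof -
  let ?N = "m + n" and ?S = "sylvester_mat_sub m n p q"
  define u where "u = vec ?N (\<lambda>j. x ^ (?N - 1 - j))"
  have S: "?S \<in> carrier_mat ?N ?N" by (rule sylvester_mat_sub_carrier)
  have "?S *\<^sub>v u = 0\<^sub>v ?N"
  proof (rule eq_vecI)
    fix i assume "i < dim_vec (0\<^sub>v ?N :: 'a vec)"
    then have i: "i < ?N" by simp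
    have "(?S *\<^sub>v u) $ i = (\<Sum>j = 0..<?N. ?S $$ (i, j) * x ^ (?N - 1 - j))"
      using i S by (simp add: u_def scalar_prod_def)
    also have "\<dots> = (\<Sum>j = 0..<?N. coeff (sylv_row m n p q i) (?N - 1 - j) * x ^ (?N - 1 - j))"
      using i by (intro sum.cong refl) (simp add: sylvester_mat_sub_index_row[OF dp dq])
    also have "\<dots> = (\<Sum>j<?N. coeff (sylv_row m n p q i) j * x ^ j)"
      unfolding atLeast0LessThan
      by (subst (2) sum.nat_diff_reindex[symmetric]) (intro sum.cong refl, simp add: algebra_simps)
    also have "\<dots> = poly (sylv_row m n p q i) x"
      unfolding poly_altdef using degree_sylv_row[OF dp dq i]
      by (intro sum.mono_neutral_right) (auto simp: coeff_eq_0)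
    also have "\<dots> = 0" using assms by (simp add: sylv_row_def)
    finally show "(?S *\<^sub>v u) $ i = 0\<^sub>v ?N $ i" using i by simp
  qed simp
  moreover have "u \<noteq> 0\<^sub>v ?N"
  proof
    assume "u = 0\<^sub>v ?N"
    then have "u $ (?N - 1) = 0" using pos by simp
    then show False using pos by (simp add: u_def)
  qed
  moreover have "u \<in> carrier_vec ?N" by (simp add: u_def)
  ultimately show ?thesis
    unfolding resultant_sub_def using det_0_iff_vec_prod_zero[OF S] by blast
qed

text \<open>Induction on the degree of \<open>p\<close>: a root of \<open>p\<close> is not a root of
  \<open>q\<close>, hence is one of \<open>b\<close>, and the linear factor can be cancelled from
  both.\<close>

lemma dvd_if_no_common_root:
  fixes p q b :: "'a::field poly"
  assumes "alg_closed TYPE('a)" "p \<noteq> 0" "p dvd b * q"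
    and "\<And>x. poly p x = 0 \<Longrightarrow> poly q x \<noteq> 0"
  shows "p dvd b"
  using assms(2-)
proof (induction "degree p" arbitrary: p b)
  case 0
  then have "p dvd 1" by (simp add: is_unit_iff_degree)
  then show ?case by (rule dvd_trans) simp
next
  case (Suc n)
  then obtain x where x: "poly p x = 0" using assms(1) unfolding alg_closed_def by (metis zero_less_Suc)
  then obtain p' where p': "p = [:-x, 1:] * p'" by (auto simp: poly_eq_0_iff_dvd dvd_def)
  have "poly b x * poly q x = 0" using Suc.prems(2) x unfolding dvd_def by (metis mult_zero_left poly_mult)
  then have "poly b x = 0" using Suc.prems(3)[OF x] by simp
  then obtain b' where b': "b = [:-x, 1:] * b'" by (auto simp: poly_eq_0_iff_dvd dvd_def)
  have "p' \<noteq> 0" using Suc.prems p' by auto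
  then have dp: "degree p = Suc (degree p')" unfolding p' by (subst degree_mult_eq) auto
  have "[:-x, 1:] * p' dvd [:-x, 1:] * (b' * q)"
    using Suc.prems(2) unfolding p' b' by (simp only: mult.assoc)
  then have "p' dvd b' * q" by (subst (asm) dvd_mult_cancel_left) simp
  moreover have "n = degree p'" using dp Suc.hyps(2) by simp
  moreover have "poly q y \<noteq> 0" if "poly p' y = 0" for y
    using Suc.prems(3)[of y] that by (simp add: p')
  ultimately have "p' dvd b'" using Suc.hyps(1)[of p' b'] \<open>p' \<noteq> 0\<close> by blast
  then show ?case unfolding p' b' by (rule mult_dvd_mono[OF dvd_refl])
qed

text \<open>A vanishing determinant gives a relation \<open>A * p + B * q = 0\<close> with
  \<open>B\<close> nonzero of degree below \<open>m\<close>. Without a common root \<open>p\<close>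
  would divide \<open>B\<close>, which the degree forbids. Here \<open>p\<close> attains its formal
  degree while that of \<open>q\<close> may drop, as happens under specialisation.\<close>

lemma common_root_if_resultant_sub_eq_0:
  fixes p q :: "'a::field poly"
  assumes closed: "alg_closed TYPE('a)"
    and dp: "degree p = m" "p \<noteq> 0" and dq: "degree q \<le> n" and res: "resultant_sub m n p q = 0"
  shows "\<exists>x. poly p x = 0 \<and> poly q x = 0"
proof (rule ccontr)
  assume nc: "\<nexists>x. poly p x = 0 \<and> poly q x = 0"
  \<comment> \<open>The transpose is used so that a kernel vector is a linear relation between the
    rows, that is, between the shifts of \<open>p\<close> and \<open>q\<close>.\<close>
  let ?N = "m + n" and ?S = "transpose_mat (sylvester_mat_sub m n p q)"
  let ?r = "sylv_row m n p q"
  have S: "?S \<in> carrier_mat ?N ?N" by (simp add: sylvester_mat_sub_carrier)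
  have "det ?S = 0" using res unfolding resultant_sub_def
    by (simp add: det_transpose[OF sylvester_mat_sub_carrier])
  then obtain v where v: "v \<in> carrier_vec ?N" "v \<noteq> 0\<^sub>v ?N" "?S *\<^sub>v v = 0\<^sub>v ?N"
    using det_0_iff_vec_prod_zero[OF S] by blast
  have sum0: "(\<Sum>i<?N. Polynomial.smult (v $ i) (?r i)) = 0"
  proof (rule poly_eqI)
    fix k
    show "coeff (\<Sum>i<?N. Polynomial.smult (v $ i) (?r i)) k = coeff 0 k"
    proof (cases "k < ?N")
      case False
      then have "coeff (?r i) k = 0" if "i < ?N" for i
        using degree_sylv_row[of p m q n i] dp dq that by (intro coeff_eq_0) auto
      then show ?thesis by (simp add: coeff_sum)
    next
      case True
      let ?j = "?N - 1 - k"
      have j: "?j < ?N" "?N - 1 - ?j = k" using True by auto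
      have "0 = (?S *\<^sub>v v) $ ?j" using v j by simp
      also have "\<dots> = (\<Sum>i = 0..<?N. sylvester_mat_sub m n p q $$ (i, ?j) * v $ i)"
        using v(1) j S by (simp add: scalar_prod_def)
      also have "\<dots> = (\<Sum>i = 0..<?N. coeff (?r i) k * v $ i)"
        using dp dq j by (intro sum.cong refl) (simp add: sylvester_mat_sub_index_row)
      finally show ?thesis by (simp add: coeff_sum atLeast0LessThan mult.commute)
    qed
  qed
  define A where "A = (\<Sum>i<n. monom (v $ i) (n - 1 - i))"
  define B where "B = (\<Sum>i = n..<?N. monom (v $ i) (?N - 1 - i))"
  have "(\<Sum>i<?N. Polynomial.smult (v $ i) (?r i)) = (\<Sum>i<n. Polynomial.smult (v $ i) (?r i)) + (\<Sum>i=n..<?N. Polynomial.smult (v $ i) (?r i))"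
    by (subst sum.union_disjoint[symmetric]) (auto intro: sum.cong)
  also have "(\<Sum>i<n. Polynomial.smult (v $ i) (?r i)) = A * p"
    unfolding A_def sum_distrib_right by (intro sum.cong refl) (simp add: sylv_row_def smult_monom mult_smult_left[symmetric])
  also have "(\<Sum>i=n..<?N. Polynomial.smult (v $ i) (?r i)) = B * q"
    unfolding B_def sum_distrib_right by (intro sum.cong refl) (simp add: sylv_row_def smult_monom mult_smult_left[symmetric])
  finally have AB: "A * p + B * q = 0" using sum0 by simp
  have cA: "coeff A (n - 1 - i) = v $ i" if "i < n" for i
  proof -
    have "coeff A (n - 1 - i) = (\<Sum>j<n. if j = i then v $ j else 0)"
      unfolding A_def coeff_sum coeff_monom using that by (intro sum.cong) auto
    then show ?thesis using that by simp
  qed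
  have cB: "coeff B (?N - 1 - i) = v $ i" if "n \<le> i" "i < ?N" for i
  proof -
    have "coeff B (?N - 1 - i) = (\<Sum>j=n..<?N. if j = i then v $ j else 0)"
      unfolding B_def coeff_sum coeff_monom using that by (intro sum.cong) auto
    then show ?thesis using that by simp
  qed
  have "B \<noteq> 0"
  proof
    assume "B = 0"
    then have "A = 0" using AB dp by simp
    have "v $ i = 0" if "i < ?N" for i
      using that cA[of i] cB[of i] \<open>A = 0\<close> \<open>B = 0\<close> by (cases "i < n") auto
    then have "v = 0\<^sub>v ?N" using v(1) by (intro eq_vecI) auto
    then show False using v(2) by simp
  qed
  have "B * q = p * (- A)" using AB by (simp add: add_eq_0_iff mult.commute)
  then have "p dvd B * q" by (rule dvdI)
  then have "p dvd B" by (rule dvd_if_no_common_root[OF closed dp(2)]) (use nc in blast)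
  then have "degree p \<le> degree B" using \<open>B \<noteq> 0\<close> by (rule dvd_imp_degree_le)
  moreover have "degree B < m" if "m > 0"
    unfolding B_def using that
    by (intro degree_sum_less) (auto intro!: le_less_trans[OF degree_monom_le])
  moreover have "B = 0" if "m = 0" using that by (simp add: B_def)
  ultimately show False using dp(1) \<open>B \<noteq> 0\<close> by (cases "m = 0") auto
qed

text \<open>The matrix is lower triangular, with \<open>n\<close> ones followed by \<open>m\<close>
  copies of \<open>coeff q 0\<close> on the diagonal.\<close>

lemma resultant_sub_monom:
  fixes q :: "'a::idom poly"
  shows "resultant_sub m n (monom 1 m) q = coeff q 0 ^ m"
proof -
  let ?S = "sylvester_mat_sub m n (monom 1 m) q"
  have S: "?S \<in> carrier_mat (m + n) (m + n)" by (rule sylvester_mat_sub_carrier)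
  have "?S $$ (i, j) = 0" if "i < j" "j < m + n" for i j
    using that by (auto simp: sylvester_mat_sub_index)
  then have "det ?S = prod_list (diag_mat ?S)"
    by (intro det_lower_triangular[OF _ S]) auto
  also have "\<dots> = (\<Prod>i<m + n. ?S $$ (i, i))"
    by (simp add: prod_list_diag_prod atLeast0LessThan)
  also have "\<dots> = (\<Prod>i<m + n. if i < n then 1 else coeff q 0)"
    by (intro prod.cong refl) (auto simp: sylvester_mat_sub_index)
  also have "\<dots> = coeff q 0 ^ card {n..<m + n}"
  proof -
    have "{..<m + n} \<inter> - {i. i < n} = {n..<m + n}" by auto
    then show ?thesis by (simp add: prod.If_cases)
  qed
  finally show ?thesis by (simp add: resultant_sub_def)
qed

text \<open>This is where the characteristic enters: a power of \<open>w - 1\<close> that is congruent to a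
  constant modulo \<open>w\<^sup>2\<close> is trivial.\<close>
lemma no_isolated_common_zero:
  fixes F G :: "'k::field_char_0 poly poly"
  assumes closed: "alg_closed TYPE('k)"
    and F: "degree F = m" "coeff F m = 1" "\<And>i. i < m \<Longrightarrow> [:0, 0, 1:] dvd coeff F i"
    and G: "coeff G 0 = [:d:]" "d \<noteq> 0"
    and only: "\<And>c x. poly (map_poly (\<lambda>p. poly p c) F) x = 0 \<Longrightarrow>
                  poly (map_poly (\<lambda>p. poly p c) G) x = 0 \<Longrightarrow> c = 1"
    and zero: "poly (map_poly (\<lambda>p. poly p 1) F) x0 = 0" "poly (map_poly (\<lambda>p. poly p 1) G) x0 = 0"
  shows False
proof -
  \<comment> \<open>The formal degree of \<open>G\<close> is fixed, although specialising the
    coefficients at \<open>c\<close> may lower the actual degree; thus the resultant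
    \<open>r\<close> commutes with specialisation.\<close>
  define n where "n = degree G"
  define r where "r = resultant_sub m n F G"
  have ev: "poly r c = resultant_sub m n (map_poly (\<lambda>p. poly p c) F) (map_poly (\<lambda>p. poly p c) G)" for c
  proof -
    have "comm_ring_hom (\<lambda>p::'k poly. poly p c)" by standard auto
    from comm_ring_hom.hom_det[OF this] show ?thesis
      unfolding r_def resultant_sub_def by (simp add: sylvester_mat_sub_map[symmetric])
  qed
  have dF: "degree (map_poly (\<lambda>p. poly p c) F) = m" for c
  proof (rule antisym)
    show "degree (map_poly (\<lambda>p. poly p c) F) \<le> m" unfolding F(1)[symmetric] by (rule degree_map_poly_le)
    show "m \<le> degree (map_poly (\<lambda>p. poly p c) F)"
      using F(2) by (intro le_degree) (simp add: coeff_map_poly)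
  qed
  have dG: "degree (map_poly (\<lambda>p. poly p c) G) \<le> n" for c unfolding n_def by (rule degree_map_poly_le)
  have nzF: "map_poly (\<lambda>p. poly p c) F \<noteq> 0" for c
  proof
    assume "map_poly (\<lambda>p. poly p c) F = 0"
    then have "coeff (map_poly (\<lambda>p. poly p c) F) m = 0" by simp
    then show False using F(2) by (simp add: coeff_map_poly)
  qed
  have root: "c = 1" if "poly r c = 0" for c
    using common_root_if_resultant_sub_eq_0[OF closed dF nzF dG that[unfolded ev]] only by blast
  have "m \<noteq> 0"
  proof
    assume "m = 0"
    then have "F = [:1:]" using degree_0_id[of F] F(1,2) by simp
    then show False using zero(1) by (simp add: map_poly_const)
  qed
  then have r1: "poly r 1 = 0" unfolding ev
    using zero dF dG by (intro resultant_sub_eq_0_if_common_root[of _ _ _ _ x0]) (auto simp: dF)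
  \<comment> \<open>Here \<open>[:0, 0, 1:]\<close> is the square of the inner variable w. Modulo it
    \<open>F\<close> becomes the power \<open>monom 1 m\<close>, so \<open>r\<close> is congruent to
    the constant \<open>d ^ m\<close>.\<close>
  have "[:0, 0, 1:] dvd r - resultant_sub m n (monom 1 m) G"
    unfolding r_def resultant_sub_def
  proof (rule det_diff_dvd[OF sylvester_mat_sub_carrier sylvester_mat_sub_carrier])
    fix i j assume ij: "i < m + n" "j < m + n"
    have "[:0, 0, 1:] dvd coeff F k - coeff (monom 1 m) k" for k
      using F by (cases "k < m"; cases "k = m") (auto simp: coeff_eq_0)
    then show "[:0, 0, 1:] dvd sylvester_mat_sub m n F G $$ (i, j) - sylvester_mat_sub m n (monom 1 m) G $$ (i, j)"
      using ij by (auto simp: sylvester_mat_sub_index simp del: coeff_monom)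
  qed
  then have "[:0, 0, 1:] dvd r - [:d ^ m:]"
    by (simp add: resultant_sub_monom G poly_const_pow)
  then obtain s where "r - [:d ^ m:] = [:0, 0, 1:] * s" by (auto simp: dvd_def)
  then have s: "r = [:d ^ m:] + [:0, 0, 1:] * s" by (simp add: algebra_simps)
  have r0: "poly r 0 \<noteq> 0" using G(2) by (simp add: s)
  have dr0: "poly (pderiv r) 0 = 0" by (simp add: s pderiv_add pderiv_mult pderiv_pCons)
  have "r \<noteq> 0" using r0 by auto
  define e where "e = Polynomial.order 1 r"
  obtain t where t: "r = [:-1, 1:] ^ e * t" "\<not> [:-1, 1:] dvd t"
    using order_decomp[OF \<open>r \<noteq> 0\<close>, of 1] unfolding e_def by auto
  \<comment> \<open>All zeros of \<open>r\<close> are equal to 1, and \<open>t\<close> is what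
    remains after removing the factor belonging to 1; over an algebraically closed field
    \<open>t\<close> is then constant.\<close>
  have "degree t = 0"
  proof (rule ccontr)
    assume "degree t \<noteq> 0"
    then obtain c where c: "poly t c = 0" using closed unfolding alg_closed_def by blast
    then have "c = 1" by (intro root) (simp add: t(1))
    then show False using c t(2) by (simp add: poly_eq_0_iff_dvd)
  qed
  then obtain b where b: "t = [:b:]" by (rule degree_eq_zeroE)
  have "e \<noteq> 0" using r1 t by (metis b mult_1 poly_eq_0_iff_dvd power_0)
  \<comment> \<open>The linear coefficient of b (w - 1)^e is a nonzero multiple of \<open>b\<close>
    in characteristic zero, yet it vanishes by the congruence modulo w^2.\<close>
  then have "poly (pderiv r) 0 = of_nat e * (-1) ^ (e - 1) * b"
    by (simp add: t(1) b pderiv_mult pderiv_power pderiv_pCons pderiv_smult)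
  with dr0 \<open>e \<noteq> 0\<close> have "b = 0" by simp
  with b t \<open>r \<noteq> 0\<close> show False by simp
qed

section \<open>Factoriality of R\<close>

definition eval_via :: "('a::comm_ring_1 \<Rightarrow> 'b::comm_ring_1) \<Rightarrow> 'b \<Rightarrow> 'a poly \<Rightarrow> 'b" where
  "eval_via h x p = poly (map_poly h p) x"

lemma comm_ring_hom_eval_via:
  assumes "comm_ring_hom h"
  shows "comm_ring_hom (eval_via h x)"
proof -
  interpret comm_ring_hom h by fact
  interpret mp: map_poly_comm_ring_hom h ..
  show ?thesis unfolding eval_via_def by standard (auto simp: mp.hom_add mp.hom_mult)
qed

lemma eval_via_pCons:
  assumes "comm_ring_hom h"
  shows "eval_via h x (pCons a p) = h a + x * eval_via h x p"
proof -
  interpret comm_ring_hom h by fact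
  show ?thesis by (simp add: eval_via_def map_poly_pCons_hom)
qed

lemma eval_via_0 [simp]: "eval_via h x 0 = 0"
  by (simp add: eval_via_def)

lemma comm_ring_hom_const: "comm_ring_hom (\<lambda>c::'a::comm_ring_1. [:c:])"
  by standard auto

text \<open>A homomorphism on univariate polynomials is determined by its values on constants and on
  the indeterminate; this peels off one layer of \<open>of_poly4\<close> at a time.\<close>

lemma hom_eval_via_eq:
  assumes h: "comm_ring_hom h" and \<phi>: "comm_ring_hom \<phi>" and e: "comm_ring_hom e"
    and "\<And>a. \<phi> (h a) = e [:a:]" "\<phi> x = e [:0, 1:]"
  shows "\<phi> (eval_via h x p) = e p"
proof (induction p)
  case 0
  interpret \<phi>: comm_ring_hom \<phi> by fact
  interpret e: comm_ring_hom e by fact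
  show ?case by simp
next
  case (pCons a p)
  interpret \<phi>: comm_ring_hom \<phi> by fact
  interpret e: comm_ring_hom e by fact
  have "pCons a p = [:a:] + [:0, 1:] * p" by simp
  then have "e (pCons a p) = e [:a:] + e [:0, 1:] * e p" by (metis e.hom_add e.hom_mult)
  then show ?case using assms(4,5) pCons by (simp add: eval_via_pCons[OF h] \<phi>.hom_add \<phi>.hom_mult)
qed

text \<open>Read as k[w][x][y][z], with w innermost. Over a field this type is an instance of
  \<open>ufd\<close>, and factoriality passes from it to \<open>Rring\<close>.\<close>

type_synonym 'k poly4 = "'k poly poly poly poly"

text \<open>\<open>L\<close> and \<open>M\<close> go to 0 by default, so \<open>to_poly4\<close> is
  faithful only on \<open>Rring\<close>; all six variables are kept by \<open>gen6\<close>.\<close>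

fun gen4 :: "var \<Rightarrow> 'k::comm_ring_1 poly4" where
  "gen4 W = [:[:[:[:0, 1:]:]:]:]"
| "gen4 X = [:[:[:0, 1:]:]:]"
| "gen4 Y = [:[:0, 1:]:]"
| "gen4 Z = [:0, 1:]"
| "gen4 _ = 0"

fun gen6 :: "var \<Rightarrow> 'k::comm_ring_1 poly4 poly poly" where
  "gen6 L = [:[:0, 1:]:]"
| "gen6 M = [:0, 1:]"
| "gen6 v = [:[:gen4 v:]:]"

definition to_poly4 :: "'k::comm_ring_1 mpoly \<Rightarrow> 'k poly4" where
  "to_poly4 = peval (\<lambda>c. [:[:[:[:c:]:]:]:]) gen4"

definition to_poly6 :: "'k::comm_ring_1 mpoly \<Rightarrow> 'k poly4 poly poly" where
  "to_poly6 = peval (\<lambda>c. [:[:[:[:[:[:c:]:]:]:]:]:]) gen6"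

definition of_poly4 :: "'k::comm_ring_1 poly4 \<Rightarrow> 'k mpoly" where
  "of_poly4 = eval_via (eval_via (eval_via (eval_via Const (Var W)) (Var X)) (Var Y)) (Var Z)"

definition of_poly6 :: "'k::comm_ring_1 poly4 poly poly \<Rightarrow> 'k mpoly" where
  "of_poly6 = eval_via (eval_via of_poly4 (Var L)) (Var M)"

lemmas const_homs =
  comm_ring_hom_const
  comm_ring_hom_comp[OF comm_ring_hom_const comm_ring_hom_const]
  comm_ring_hom_comp[OF comm_ring_hom_comp[OF comm_ring_hom_const comm_ring_hom_const] comm_ring_hom_const]

lemma comm_ring_hom_const4: "comm_ring_hom (\<lambda>c::'k::comm_ring_1. [:[:[:[:c:]:]:]:])"
  by standard auto

lemma comm_ring_hom_const6: "comm_ring_hom (\<lambda>c::'k::comm_ring_1. [:[:[:[:[:[:c:]:]:]:]:]:])"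
  by standard auto

lemma comm_ring_hom_to_poly4: "comm_ring_hom (to_poly4 :: 'k::comm_ring_1 mpoly \<Rightarrow> _)"
  unfolding to_poly4_def by (rule comm_ring_hom_peval[OF comm_ring_hom_const4])

lemma comm_ring_hom_to_poly6: "comm_ring_hom (to_poly6 :: 'k::comm_ring_1 mpoly \<Rightarrow> _)"
  unfolding to_poly6_def by (rule comm_ring_hom_peval[OF comm_ring_hom_const6])

lemma comm_ring_hom_of_poly4: "comm_ring_hom (of_poly4 :: 'k::comm_ring_1 poly4 \<Rightarrow> _)"
  unfolding of_poly4_def by (intro comm_ring_hom_eval_via comm_ring_hom_Const)

lemma comm_ring_hom_of_poly6: "comm_ring_hom (of_poly6 :: 'k::comm_ring_1 poly4 poly poly \<Rightarrow> _)"
  unfolding of_poly6_def by (intro comm_ring_hom_eval_via comm_ring_hom_of_poly4)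

lemma to_poly4_of_poly4: "to_poly4 (of_poly4 p) = (p :: 'k::comm_ring_1 poly4)"
proof -
  note hc = comm_ring_hom_Const[where 'a = 'k]
  note h1 = comm_ring_hom_eval_via[OF hc, of "Var W"]
  note h2 = comm_ring_hom_eval_via[OF h1, of "Var X"]
  note h3 = comm_ring_hom_eval_via[OF h2, of "Var Y"]
  note \<phi> = comm_ring_hom_to_poly4[where 'k = 'k]
  have v: "to_poly4 (Var u) = (gen4 u :: 'k poly4)" for u
    by (simp add: to_poly4_def comm_ring_hom_const4)
  have c: "to_poly4 (Const a) = [:[:[:[:a:]:]:]:]" for a :: 'k
    by (simp add: to_poly4_def peval_Const comm_ring_hom_const4)
  have 1: "to_poly4 (eval_via Const (Var W) p) = [:[:[:p:]:]:]" for p :: "'k poly"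
    by (rule hom_eval_via_eq[OF hc \<phi>, of "\<lambda>p. [:[:[:p:]:]:]"]) (auto simp: v c const_homs)
  have 2: "to_poly4 (eval_via (eval_via Const (Var W)) (Var X) p) = [:[:p:]:]" for p :: "'k poly poly"
    by (rule hom_eval_via_eq[OF h1 \<phi>, of "\<lambda>p. [:[:p:]:]"]) (auto simp: v 1 const_homs)
  have 3: "to_poly4 (eval_via (eval_via (eval_via Const (Var W)) (Var X)) (Var Y) p) = [:p:]"
    for p :: "'k poly poly poly"
    by (rule hom_eval_via_eq[OF h2 \<phi>, of "\<lambda>p. [:p:]"]) (auto simp: v 2 const_homs)
  show ?thesis unfolding of_poly4_def
    by (rule hom_eval_via_eq[OF h3 \<phi>, of "\<lambda>p. p"]) (auto simp: v 3 comm_ring_hom_ident)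
qed

lemma of_poly4_Const: "of_poly4 [:[:[:[:a:]:]:]:] = Const (a :: 'k::comm_ring_1)"
  by (simp add: of_poly4_def eval_via_pCons comm_ring_hom_eval_via comm_ring_hom_Const)

lemma eval_via_const:
  assumes "comm_ring_hom h"
  shows "eval_via h x [:a:] = h a"
  by (simp add: eval_via_pCons[OF assms])

lemma eval_via_X:
  assumes "comm_ring_hom h"
  shows "eval_via h x [:0, 1:] = x" "eval_via h x (pCons 0 1) = x"
proof -
  interpret comm_ring_hom h by fact
  interpret ev: comm_ring_hom "eval_via h x" by (rule comm_ring_hom_eval_via[OF assms])
  show "eval_via h x [:0, 1:] = x" "eval_via h x (pCons 0 1) = x"
    by (simp_all add: eval_via_pCons[OF assms])
qed

text \<open>The composite fixes constants and variables. As a left inverse, \<open>of_poly6\<close>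
  pulls a divisibility in the iterated ring back to S.\<close>

lemma of_poly6_to_poly6: "of_poly6 (to_poly6 p) = (p :: 'k::comm_ring_1 mpoly)"
proof -
  note homs = comm_ring_hom_eval_via comm_ring_hom_of_poly4 comm_ring_hom_Const
  have "comm_ring_hom (\<lambda>p::'k mpoly. of_poly6 (to_poly6 p))"
    by (rule comm_ring_hom_comp[OF comm_ring_hom_to_poly6 comm_ring_hom_of_poly6])
  then have "(\<lambda>p::'k mpoly. of_poly6 (to_poly6 p)) p = (\<lambda>p. p) p"
  proof (rule hom_eqI[OF _ comm_ring_hom_ident])
    fix a :: 'k
    have "to_poly6 (Const a) = [:[:[:[:[:[:a:]:]:]:]:]:]"
      by (simp add: to_poly6_def peval_Const comm_ring_hom_const6)
    then show "of_poly6 (to_poly6 (Const a)) = Const a"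
      by (simp add: of_poly6_def eval_via_const homs of_poly4_Const)
  next
    fix v
    have "to_poly6 (Var v) = (gen6 v :: 'k poly4 poly poly)"
      by (simp add: to_poly6_def comm_ring_hom_const6)
    then show "of_poly6 (to_poly6 (Var v)) = (Var v :: 'k mpoly)"
      by (cases v) (simp_all add: of_poly6_def of_poly4_def eval_via_const eval_via_X homs)
  qed
  then show ?thesis .
qed

lemma peval_cong:
  assumes "\<And>v. v \<in> vars p \<Longrightarrow> \<sigma> v = \<tau> v"
  shows "peval c \<sigma> p = peval c \<tau> p"
  unfolding peval_def using assms
  by (intro sum.cong arg_cong[where f = "\<lambda>x. _ * x"] prod.cong arg_cong[where f = "\<lambda>x. x ^ _"] refl)
     (auto simp: vars_def)

lemma to_poly6_Rring:
  fixes p :: "'k::comm_ring_1 mpoly"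
  assumes "p \<in> Rring"
  shows "to_poly6 p = [:[:to_poly4 p:]:]"
proof -
  have "comm_ring_hom (\<lambda>p::'k mpoly. [:[:to_poly4 p:]:])"
    by (rule comm_ring_hom_comp[OF comm_ring_hom_to_poly4 const_homs(2)])
  from hom_eq_peval[OF this, of p]
  have "[:[:to_poly4 p:]:] = peval (\<lambda>a. [:[:to_poly4 (Const a):]:]) (\<lambda>v. [:[:to_poly4 (Var v):]:]) p" .
  also have "\<dots> = peval (\<lambda>c. [:[:[:[:[:[:c:]:]:]:]:]:]) (\<lambda>v. [:[:gen4 v:]:]) p"
    by (simp add: to_poly4_def peval_Const comm_ring_hom_const4)
  also have "\<dots> = to_poly6 p" unfolding to_poly6_def
    by (rule peval_cong) (use assms in \<open>auto simp: Rring_def\<close>)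
  finally show ?thesis ..
qed

lemma vars_add: "vars (p + q) \<subseteq> vars p \<union> vars q"
  using keys_add[of p q] by (auto simp: vars_def)

lemma vars_mult: "vars (p * q) \<subseteq> vars p \<union> vars (q :: 'k::comm_ring_1 mpoly)"
proof
  fix v assume "v \<in> vars (p * q)"
  then obtain m where "m \<in> Poly_Mapping.keys (p * q)" and v: "v \<in> Poly_Mapping.keys m"
    by (auto simp: vars_def)
  then obtain a b where ab: "a \<in> Poly_Mapping.keys p" "b \<in> Poly_Mapping.keys q" "m = a + b"
    using keys_mult[of p q] by auto
  then have "v \<in> Poly_Mapping.keys a \<union> Poly_Mapping.keys b" using v keys_add[of a b] by blast
  then show "v \<in> vars p \<union> vars q" using ab by (auto simp: vars_def)
qed

lemma Rring_0 [simp]: "0 \<in> Rring"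
  by (simp add: Rring_def vars_def)

lemma Rring_Const [simp]: "Const c \<in> Rring"
  by (simp add: Rring_def vars_def Const_def)

lemma Rring_Var: "v \<in> {W, X, Y, Z} \<Longrightarrow> (Var v :: 'k::comm_ring_1 mpoly) \<in> Rring"
  by (auto simp: Rring_def vars_def Var_def)

lemma Rring_add: "p \<in> Rring \<Longrightarrow> q \<in> Rring \<Longrightarrow> p + q \<in> Rring"
  using vars_add[of p q] unfolding Rring_def by blast

lemma Rring_mult: "p \<in> Rring \<Longrightarrow> q \<in> Rring \<Longrightarrow> p * q \<in> Rring" for p :: "'k::comm_ring_1 mpoly"
  using vars_mult[of p q] unfolding Rring_def by blast

lemma eval_via_Rring:
  assumes "comm_ring_hom h" "\<And>a. h a \<in> Rring" "x \<in> Rring"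
  shows "eval_via h x p \<in> Rring"
  by (induction p) (auto simp: eval_via_pCons assms Rring_add Rring_mult)

lemma of_poly4_Rring: "of_poly4 p \<in> Rring"
  unfolding of_poly4_def
  by (intro eval_via_Rring comm_ring_hom_eval_via comm_ring_hom_Const Rring_Const Rring_Var) auto

lemma of_poly6_const: "of_poly6 [:[:p:]:] = of_poly4 p"
  by (simp add: of_poly6_def eval_via_const comm_ring_hom_eval_via comm_ring_hom_of_poly4)

lemma of_poly4_to_poly4:
  assumes "p \<in> Rring"
  shows "of_poly4 (to_poly4 p) = p"
  by (metis assms of_poly6_const of_poly6_to_poly6 to_poly6_Rring)

section \<open>Divisibility in S by elements of R\<close>

lemma dvd_if_to_poly6_dvd:
  assumes "to_poly6 p dvd to_poly6 q"
  shows "p dvd q"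
proof -
  interpret comm_ring_hom "of_poly6 :: 'a poly4 poly poly \<Rightarrow> _" by (rule comm_ring_hom_of_poly6)
  from assms obtain u where "to_poly6 q = to_poly6 p * u" by (auto simp: dvd_def)
  then have "q = p * of_poly6 u" by (metis hom_mult of_poly6_to_poly6)
  then show ?thesis by simp
qed

text \<open>The prime factors of \<open>b\<close> are removed one at a time: none divides
  \<open>a\<close>, so each divides the remaining part of \<open>c\<close>.\<close>

lemma ufd_dvd_mult_cancel:
  fixes a b c :: "'a::ufd"
  assumes "b \<noteq> 0" "b dvd c * a" and cop: "\<And>d. d dvd a \<Longrightarrow> d dvd b \<Longrightarrow> d dvd 1"
  shows "b dvd c"
  using assms
proof (cases "b dvd 1")
  case True
  then show ?thesis using dvd_trans one_dvd by blast
next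
  case False
  have main: "prod_mset F dvd c" if "\<And>f. f \<in># F \<Longrightarrow> irreducible f" "prod_mset F dvd b" "prod_mset F dvd c * a"
    for F c
    using that
  proof (induction F arbitrary: c)
    case (add p F)
    have p: "prime_elem p" using add.prems(1)[of p] by simp
    have "p dvd prod_mset (add_mset p F)" "prod_mset F dvd prod_mset (add_mset p F)" by auto
    note d = dvd_trans[OF this(1)] dvd_trans[OF this(2)]
    have "p dvd b" by (rule d(1)[OF add.prems(2)])
    then have "\<not> p dvd a" using cop[of p] p by (auto simp: prime_elem_def)
    moreover have "p dvd c * a" by (rule d(1)[OF add.prems(3)])
    ultimately have "p dvd c" using prime_elem_dvd_multD[OF p] by blast
    then obtain c' where c': "c = p * c'" by (auto simp: dvd_def)
    have "p * prod_mset F dvd p * (c' * a)" using add.prems(3) by (simp only: c' mult.assoc prod_mset.add_mset)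
    moreover have "p \<noteq> 0" using p by (rule prime_elem_not_zeroI)
    ultimately have "prod_mset F dvd c' * a" by (subst (asm) dvd_mult_cancel_left) blast
    moreover have "prod_mset F dvd b" by (rule d(2)[OF add.prems(2)])
    ultimately have "prod_mset F dvd c'" using add.IH[of c'] add.prems(1) by simp
    then show ?case unfolding c' prod_mset.add_mset by (rule mult_dvd_mono[OF dvd_refl])
  qed simp
  obtain F where "mset_factors F b" using mset_factors_exist assms(1) False by blast
  then show ?thesis using main[of F c] assms(2) by auto
qed

text \<open>Divisibility by a constant polynomial is tested coefficientwise, so the cancellation law
  passes from the coefficient ring to polynomials over it.\<close>

lemma const_poly_dvd_mult_cancel:
  fixes a b :: "'a::idom"
  assumes "\<And>c. b dvd c * a \<Longrightarrow> b dvd c"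
    and "[:b:] dvd c * [:a:]"
  shows "[:b:] dvd c"
  unfolding const_poly_dvd_iff
proof
  fix n
  have "b dvd coeff (c * [:a:]) n" using assms(2) unfolding const_poly_dvd_iff ..
  also have "coeff (c * [:a:]) n = coeff c n * a" by (simp add: mult.commute)
  finally show "b dvd coeff c n" by (rule assms(1))
qed

text \<open>Coprimality is a condition in R while the divisibility is one in S. In the iterated ring
  \<open>a\<close> and \<open>b\<close> are constant in \<lambda> and \<mu>, so the law for the
  factorial ring R is lifted through two polynomial layers.\<close>

lemma Rring_dvd_mult_cancel:
  fixes a b c :: "'k::field mpoly"
  assumes R: "a \<in> Rring" "b \<in> Rring" and "b \<noteq> 0" and dvd: "b dvd c * a"
    and cop: "\<And>d. d \<in> Rring \<Longrightarrow> dvd_in Rring d a \<Longrightarrow> dvd_in Rring d b \<Longrightarrow> dvd_in Rring d 1"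
  shows "b dvd c"
proof (rule dvd_if_to_poly6_dvd)
  interpret \<phi>: comm_ring_hom "to_poly4 :: 'k mpoly \<Rightarrow> _" by (rule comm_ring_hom_to_poly4)
  interpret \<psi>: comm_ring_hom "of_poly4 :: 'k poly4 \<Rightarrow> _" by (rule comm_ring_hom_of_poly4)
  interpret \<Phi>: comm_ring_hom "to_poly6 :: 'k mpoly \<Rightarrow> _" by (rule comm_ring_hom_to_poly6)
  have *: "dvd_in Rring (of_poly4 d) x" if "d dvd to_poly4 x" "x \<in> Rring" for d and x :: "'k mpoly"
  proof -
    from that(1) obtain u where "to_poly4 x = d * u" by (rule dvdE)
    then have "of_poly4 (to_poly4 x) = of_poly4 d * of_poly4 u" by (simp only: \<psi>.hom_mult)
    then show ?thesis using of_poly4_Rring[of u] of_poly4_to_poly4[OF that(2)]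
      unfolding dvd_in_def by metis
  qed
  have cancel: "to_poly4 b dvd c" if "to_poly4 b dvd c * to_poly4 a" for c
  proof (rule ufd_dvd_mult_cancel[OF _ that])
    show "to_poly4 b \<noteq> 0" using \<open>b \<noteq> 0\<close> of_poly4_to_poly4[OF R(2)] by auto
    fix d assume "d dvd to_poly4 a" "d dvd to_poly4 b"
    then have "dvd_in Rring (of_poly4 d) 1" using * R cop of_poly4_Rring by blast
    then have "to_poly4 (of_poly4 d) dvd to_poly4 1"
      unfolding dvd_in_def by (metis \<phi>.hom_mult dvd_triv_left)
    then show "d dvd 1" by (simp add: to_poly4_of_poly4)
  qed
  have "to_poly6 b dvd to_poly6 c * to_poly6 a"
    using dvd by (metis \<Phi>.hom_mult dvd_def dvd_triv_left)
  then show "to_poly6 b dvd to_poly6 c"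
    unfolding to_poly6_Rring[OF R(1)] to_poly6_Rring[OF R(2)]
    by (rule const_poly_dvd_mult_cancel[rotated])
       (rule const_poly_dvd_mult_cancel[rotated], assumption, rule cancel)
qed

text \<open>The value of \<open>f\<close> is the product of the values of its irreducible factors,
  so one of them vanishes at the point. It is prime by factoriality and stays prime in S as a
  constant polynomial.\<close>

lemma Rring_prime_factor:
  fixes f :: "'k::field mpoly"
  assumes f: "f \<in> Rring" "f \<noteq> 0" and zero: "peval id \<sigma> f = 0"
  obtains p where "p \<in> Rring" "p dvd f" "peval id \<sigma> p = 0"
    "\<And>u v. p dvd u * v \<Longrightarrow> p dvd u \<or> p dvd v"
proof -
  interpret \<phi>: comm_ring_hom "to_poly4 :: 'k mpoly \<Rightarrow> _" by (rule comm_ring_hom_to_poly4)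
  interpret \<psi>: comm_ring_hom "of_poly4 :: 'k poly4 \<Rightarrow> _" by (rule comm_ring_hom_of_poly4)
  interpret \<Phi>: comm_ring_hom "to_poly6 :: 'k mpoly \<Rightarrow> _" by (rule comm_ring_hom_to_poly6)
  interpret ev: comm_ring_hom "peval id \<sigma> :: 'k mpoly \<Rightarrow> 'k" by (rule comm_ring_hom_peval[OF comm_ring_hom_id])
  have nz: "to_poly4 f \<noteq> 0" using f of_poly4_to_poly4 by fastforce
  have "\<not> to_poly4 f dvd 1"
  proof
    assume "to_poly4 f dvd 1"
    then obtain u where "1 = to_poly4 f * u" by (auto simp: dvd_def)
    then have "1 = f * of_poly4 u" by (metis \<psi>.hom_mult \<psi>.hom_one f(1) of_poly4_to_poly4)
    then have "1 = peval id \<sigma> f * peval id \<sigma> (of_poly4 u)" by (metis ev.hom_mult ev.hom_one)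
    then show False using zero by simp
  qed
  then obtain F where F: "mset_factors F (to_poly4 f)" using mset_factors_exist nz by blast
  have "\<exists>p\<in>#F. peval id \<sigma> (of_poly4 p) = 0"
  proof (rule ccontr)
    assume "\<not> ?thesis"
    then have "peval id \<sigma> (of_poly4 (prod_mset F)) \<noteq> 0"
      by (induction F) (auto simp: \<psi>.hom_mult ev.hom_mult)
    then show False using F zero f of_poly4_to_poly4 by (metis mset_factorsD(3))
  qed
  then obtain p where p: "p \<in># F" "peval id \<sigma> (of_poly4 p) = 0" by blast
  have "prime_elem p" using F p(1) by auto
  then have pr: "prime_elem (to_poly6 (of_poly4 p))"
    unfolding to_poly6_Rring[OF of_poly4_Rring] to_poly4_of_poly4 by (simp only: prime_elem_const_poly_iff)
  have "p dvd to_poly4 f" using F p(1) by (metis dvd_prod_mset mset_factorsD(3))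
  then have "of_poly4 p dvd f" by (metis \<psi>.hom_mult dvd_def f(1) of_poly4_to_poly4)
  moreover have "of_poly4 p dvd u \<or> of_poly4 p dvd v" if "of_poly4 p dvd u * v" for u v
  proof -
    have "to_poly6 (of_poly4 p) dvd to_poly6 u * to_poly6 v"
      using that by (metis \<Phi>.hom_mult dvd_def dvd_triv_left)
    then show ?thesis using pr dvd_if_to_poly6_dvd by (auto simp: prime_elem_dvd_mult_iff)
  qed
  ultimately show ?thesis using that of_poly4_Rring p(2) by blast
qed

section \<open>Bihomogeneous surfaces through the curve\<close>

definition bidegw :: "var \<Rightarrow> nat" where
  "bidegw v = (case v of W \<Rightarrow> 4 | X \<Rightarrow> 3 | Y \<Rightarrow> 1 | _ \<Rightarrow> 0)"

definition point :: "'k \<Rightarrow> 'k \<Rightarrow> 'k \<Rightarrow> 'k \<Rightarrow> var \<Rightarrow> 'k::zero" where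
  "point w x y z v = (case v of W \<Rightarrow> w | X \<Rightarrow> x | Y \<Rightarrow> y | Z \<Rightarrow> z | _ \<Rightarrow> 0)"

lemma point_simps [simp]:
  "point w x y z W = w" "point w x y z X = x" "point w x y z Y = y" "point w x y z Z = z"
  "point w x y z L = 0" "point w x y z M = 0"
  by (simp_all add: point_def)

lemma wdeg_bidegw: "wdeg bidegw m = bideg1 m"
  by (simp add: wdeg_def UNIV_var bidegw_def bideg1_def)

lemma wdeg_1: "wdeg (\<lambda>_. 1) m = mdeg m"
proof -
  have "mdeg m = (\<Sum>v\<in>UNIV. Poly_Mapping.lookup m v)"
    unfolding mdeg_def by (rule sum.mono_neutral_left) (auto simp: in_keys_iff)
  then show ?thesis by (simp add: wdeg_def)
qed

lemma mdeg_eq: "mdeg m = Poly_Mapping.lookup m W + Poly_Mapping.lookup m X + Poly_Mapping.lookup m Y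
    + Poly_Mapping.lookup m Z + Poly_Mapping.lookup m L + Poly_Mapping.lookup m M"
  by (simp add: wdeg_1[symmetric] wdeg_def UNIV_var)

lemma homogeneous_iff_whom: "homogeneous p d \<longleftrightarrow> whom (\<lambda>_. 1) p d"
  by (simp only: homogeneous_def whom_def wdeg_1)

lemma whom_1D: "whom (\<lambda>_. 1) p d \<Longrightarrow> m \<in> Poly_Mapping.keys p \<Longrightarrow> mdeg m = d"
  unfolding homogeneous_iff_whom[symmetric] homogeneous_def by blast

lemma monomial_eqI:
  assumes "Poly_Mapping.lookup m W = Poly_Mapping.lookup n W"
    "Poly_Mapping.lookup m X = Poly_Mapping.lookup n X"
    "Poly_Mapping.lookup m Y = Poly_Mapping.lookup n Y"
    "Poly_Mapping.lookup m Z = Poly_Mapping.lookup n Z"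
    "Poly_Mapping.lookup m L = Poly_Mapping.lookup n L"
    "Poly_Mapping.lookup m M = Poly_Mapping.lookup n M"
  shows "m = n"
proof (rule poly_mapping_eqI)
  fix v show "Poly_Mapping.lookup m v = Poly_Mapping.lookup n v" using assms by (cases v) auto
qed

lemma mon_eval_point:
  "mon_eval (point w x y z) m = w ^ Poly_Mapping.lookup m W * x ^ Poly_Mapping.lookup m X
     * y ^ Poly_Mapping.lookup m Y * z ^ Poly_Mapping.lookup m Z
     * (0 ^ Poly_Mapping.lookup m L * 0 ^ Poly_Mapping.lookup m M)"
  by (simp add: mon_eval_def UNIV_var mult.assoc)

lemma peval_eq_sum: "peval id \<sigma> p = (\<Sum>m\<in>Poly_Mapping.keys p. Poly_Mapping.lookup p m * mon_eval \<sigma> m)"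
  by (simp add: peval_def mon_eval_keys)

lemma Rring_lookup:
  assumes "p \<in> Rring" "m \<in> Poly_Mapping.keys p"
  shows "Poly_Mapping.lookup m L = 0" "Poly_Mapping.lookup m M = 0"
  using assms unfolding Rring_def vars_def by (fastforce simp: in_keys_iff)+

lemma mon_eval_point_Rring:
  assumes "p \<in> Rring" "m \<in> Poly_Mapping.keys p"
  shows "mon_eval (point w x y z) m = w ^ Poly_Mapping.lookup m W * x ^ Poly_Mapping.lookup m X
     * y ^ Poly_Mapping.lookup m Y * z ^ Poly_Mapping.lookup m Z"
  by (simp add: mon_eval_point Rring_lookup[OF assms])

text \<open>At the point [0:1:0:0] only pure powers of x survive, and the degree fixes the
  exponent.\<close>

lemma X_power_in_keys:
  fixes p :: "'k::field mpoly"
  assumes "whom (\<lambda>_. 1) p a" "peval id (point 0 1 0 0) p \<noteq> 0"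
  shows "Poly_Mapping.single X a \<in> Poly_Mapping.keys p"
proof -
  obtain m where m: "m \<in> Poly_Mapping.keys p" "mon_eval (point 0 1 0 0) m \<noteq> (0 :: 'k)"
    using assms(2) unfolding peval_eq_sum by (auto elim: sum.not_neutral_contains_not_neutral)
  then have 0: "Poly_Mapping.lookup m W = 0" "Poly_Mapping.lookup m Y = 0" "Poly_Mapping.lookup m Z = 0"
    "Poly_Mapping.lookup m L = 0" "Poly_Mapping.lookup m M = 0"
    by (auto simp: mon_eval_point power_0_left split: if_splits)
  moreover have "mdeg m = a" using assms(1) m(1) by (rule whom_1D)
  ultimately have "m = Poly_Mapping.single X a"
    by (intro monomial_eqI) (auto simp: mdeg_eq lookup_single)
  with m show ?thesis by simp
qed

lemma Y_power_in_keys: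
  fixes p :: "'k::field mpoly"
  assumes "whom (\<lambda>_. 1) p a" "peval id (point 0 0 1 0) p \<noteq> 0"
  shows "Poly_Mapping.single Y a \<in> Poly_Mapping.keys p"
proof -
  obtain m where m: "m \<in> Poly_Mapping.keys p" "mon_eval (point 0 0 1 0) m \<noteq> (0 :: 'k)"
    using assms(2) unfolding peval_eq_sum by (auto elim: sum.not_neutral_contains_not_neutral)
  then have 0: "Poly_Mapping.lookup m W = 0" "Poly_Mapping.lookup m X = 0" "Poly_Mapping.lookup m Z = 0"
    "Poly_Mapping.lookup m L = 0" "Poly_Mapping.lookup m M = 0"
    by (auto simp: mon_eval_point power_0_left split: if_splits)
  moreover have "mdeg m = a" using assms(1) m(1) by (rule whom_1D)
  ultimately have "m = Poly_Mapping.single Y a"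
    by (intro monomial_eqI) (auto simp: mdeg_eq lookup_single)
  with m show ?thesis by simp
qed

text \<open>Such a \<open>p\<close> contains the \<open>a\<close>-th powers of both x and y, whose
  first degrees \<open>3 * a\<close> and \<open>a\<close> agree only for \<open>a = 0\<close>. Hence
  \<open>p\<close> is a nonzero constant.\<close>

lemma bihomogeneous_nonvanishing:
  fixes p :: "'k::field mpoly"
  assumes hom: "whom (\<lambda>_. 1) p a" "whom bidegw p A"
    and nz: "peval id (point 0 1 0 0) p \<noteq> 0" "peval id (point 0 0 1 0) p \<noteq> 0"
  shows "peval id \<sigma> p \<noteq> 0"
proof -
  have kX: "Poly_Mapping.single X a \<in> Poly_Mapping.keys p" and kY: "Poly_Mapping.single Y a \<in> Poly_Mapping.keys p"
    using X_power_in_keys Y_power_in_keys hom(1) nz by blast+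
  then have "bideg1 (Poly_Mapping.single X a) = bideg1 (Poly_Mapping.single Y a)"
    using hom(2) by (simp add: whom_def wdeg_bidegw)
  then have "a = 0" by (simp add: bideg1_def lookup_single)
  have "m = 0" if "m \<in> Poly_Mapping.keys p" for m
  proof -
    have "mdeg m = 0" using whom_1D[OF hom(1) that] \<open>a = 0\<close> by simp
    then show ?thesis by (intro monomial_eqI) (auto simp: mdeg_eq)
  qed
  moreover have "0 \<in> Poly_Mapping.keys p" using kX \<open>a = 0\<close> by simp
  ultimately have "Poly_Mapping.keys p = {0}" by blast
  then have "peval id \<sigma> p = Poly_Mapping.lookup p 0 \<and> Poly_Mapping.lookup p 0 \<noteq> 0"
    by (auto simp: peval_eq_sum in_keys_iff[symmetric])
  then show ?thesis by simp
qed

text \<open>Along the points (c, t, 1/t, 1), and after multiplication by a power of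
  \<open>t\<close>, both polynomials depend on \<open>t\<close> only through \<xi> = t^4. Since xy =
  wz reads 1 = c there, \<open>no_isolated_common_zero\<close> applies.\<close>

lemma no_bihomogeneous_pair:
  fixes u v :: "'k::field_char_0 mpoly"
  assumes closed: "alg_closed TYPE('k)"
    and R: "u \<in> Rring" "v \<in> Rring"
    and homu: "whom (\<lambda>_. 1) u a" "whom bidegw u A"
    and homv: "whom (\<lambda>_. 1) v b" "whom bidegw v B"
    and kX: "Poly_Mapping.single X a \<in> Poly_Mapping.keys u"
    and kY: "Poly_Mapping.single Y b \<in> Poly_Mapping.keys v"
    and e: "peval id (point 1 1 1 1) u = 0" "peval id (point 1 1 1 1) v = 0"
    and only: "\<And>w x y z. peval id (point w x y z) u = 0 \<Longrightarrow> peval id (point w x y z) v = 0 \<Longrightarrow> x * y = w * z"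
  shows False
proof -
  let ?l = Poly_Mapping.lookup
  define c0 where "c0 = ?l u (Poly_Mapping.single X a)"
  define d where "d = ?l v (Poly_Mapping.single Y b)"
  have nz: "c0 \<noteq> 0" "d \<noteq> 0" using kX kY by (auto simp: c0_def d_def in_keys_iff)
  have "A = bideg1 (Poly_Mapping.single X a)" using homu(2) kX by (simp add: whom_def wdeg_bidegw)
  then have A: "A = 3 * a" by (simp add: bideg1_def lookup_single)
  have "B = bideg1 (Poly_Mapping.single Y b)" using homv(2) kY by (simp add: whom_def wdeg_bidegw)
  then have B: "B = b" by (simp add: bideg1_def lookup_single)
  \<comment> \<open>Solved from degree \<open>a\<close> and first degree \<open>3 * a\<close>. In
    particular a monomial of \<open>u\<close> involving y or z has w-exponent at least 2.\<close>
  have ku: "?l m W = 2 * ?l m Y + 3 * ?l m Z" "?l m X + 3 * ?l m Y + 4 * ?l m Z = a"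
    if "m \<in> Poly_Mapping.keys u" for m
  proof -
    have "mdeg m = a" "bideg1 m = 3 * a"
      using whom_1D[OF homu(1) that] homu(2) that A by (simp_all add: whom_def wdeg_bidegw)
    then show "?l m W = 2 * ?l m Y + 3 * ?l m Z" "?l m X + 3 * ?l m Y + 4 * ?l m Z = a"
      using Rring_lookup[OF R(1) that] by (auto simp: mdeg_eq bideg1_def)
  qed
  have kv: "4 * ?l m W + 3 * ?l m X + ?l m Y = b" "?l m W + ?l m X + ?l m Y + ?l m Z = b"
    if "m \<in> Poly_Mapping.keys v" for m
  proof -
    have "mdeg m = b" "bideg1 m = b"
      using whom_1D[OF homv(1) that] homv(2) that B by (simp_all add: whom_def wdeg_bidegw)
    then show "4 * ?l m W + 3 * ?l m X + ?l m Y = b" "?l m W + ?l m X + ?l m Y + ?l m Z = b"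
      using Rring_lookup[OF R(2) that] by (auto simp: mdeg_eq bideg1_def)
  qed
  \<comment> \<open>The outer variable is \<xi>. Multiplied by \<open>t ^ (3 * a)\<close>, a
    monomial of \<open>u\<close> with exponents (W, X, Y, Z) has t-exponent 4 (a - Y - Z);
    multiplied by \<open>t ^ b\<close>, one of \<open>v\<close> has t-exponent 4 (W + X). By
    \<open>ku\<close> the subtraction is not truncated, and dividing by \<open>c0\<close> makes
    \<open>F\<close> monic.\<close>
  define F :: "'k poly poly" where
    "F = (\<Sum>m\<in>Poly_Mapping.keys u. monom (monom (?l u m / c0) (?l m W)) (a - ?l m Y - ?l m Z))"
  define G :: "'k poly poly" where
    "G = (\<Sum>m\<in>Poly_Mapping.keys v. monom (monom (?l v m) (?l m W)) (?l m W + ?l m X))"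
  have coF: "coeff F a = 1"
  proof -
    have iff: "a - ?l m Y - ?l m Z = a \<longleftrightarrow> m = Poly_Mapping.single X a" if m: "m \<in> Poly_Mapping.keys u" for m
    proof
      assume "a - ?l m Y - ?l m Z = a"
      then have "?l m Y = 0 \<and> ?l m Z = 0" using ku[OF m] by linarith
      then show "m = Poly_Mapping.single X a"
        using ku[OF m] Rring_lookup[OF R(1) m] by (intro monomial_eqI) (auto simp: lookup_single)
    qed (simp add: lookup_single)
    have "coeff F a = (\<Sum>m\<in>Poly_Mapping.keys u. if m = Poly_Mapping.single X a then 1 else 0)"
      unfolding F_def coeff_sum coeff_monom
    proof (rule sum.cong[OF refl])
      fix m assume "m \<in> Poly_Mapping.keys u"
      from iff[OF this] show "(if a - ?l m Y - ?l m Z = a then monom (?l u m / c0) (?l m W) else 0)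
          = (if m = Poly_Mapping.single X a then 1 else 0)"
        using nz by (simp add: c0_def lookup_single monom_0 pCons_one)
    qed
    then show ?thesis using kX by simp
  qed
  have dF: "degree F = a"
  proof (rule antisym)
    show "degree F \<le> a" unfolding F_def
      by (intro degree_sum_le finite_keys order_trans[OF degree_monom_le]) auto
    show "a \<le> degree F" using coF by (intro le_degree) simp
  qed
  have dvdF: "[:0, 0, 1:] dvd coeff F i" if "i < a" for i
    unfolding F_def coeff_sum
  proof (rule dvd_sum)
    fix m assume m: "m \<in> Poly_Mapping.keys u"
    show "[:0, 0, 1:] dvd coeff (monom (monom (?l u m / c0) (?l m W)) (a - ?l m Y - ?l m Z)) i"
    proof (cases "a - ?l m Y - ?l m Z = i")
      case True
      then have "2 \<le> ?l m W" using ku[OF m] that by linarith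
      then have "monom (?l u m / c0) (?l m W) = [:0, 0, 1:] * monom (?l u m / c0) (?l m W - 2)"
        by (metis (no_types, opaque_lifting) le_add_diff_inverse mult_1 mult_monom monom_Suc monom_0 numeral_2_eq_2)
      then have "[:0, 0, 1:] dvd monom (?l u m / c0) (?l m W)" by (rule dvdI)
      then show ?thesis using True unfolding coeff_monom by simp
    qed simp
  qed
  have coG: "coeff G 0 = [:d:]"
  proof -
    have iff: "?l m W + ?l m X = 0 \<longleftrightarrow> m = Poly_Mapping.single Y b" if m: "m \<in> Poly_Mapping.keys v" for m
    proof
      assume "?l m W + ?l m X = 0"
      then show "m = Poly_Mapping.single Y b"
        using kv[OF m] Rring_lookup[OF R(2) m] by (intro monomial_eqI) (auto simp: lookup_single)
    qed (simp add: lookup_single)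
    have "coeff G 0 = (\<Sum>m\<in>Poly_Mapping.keys v. if m = Poly_Mapping.single Y b then [:d:] else 0)"
      unfolding G_def coeff_sum coeff_monom
    proof (rule sum.cong[OF refl])
      fix m assume "m \<in> Poly_Mapping.keys v"
      from iff[OF this] show "(if ?l m W + ?l m X = 0 then monom (?l v m) (?l m W) else 0)
          = (if m = Poly_Mapping.single Y b then [:d:] else 0)"
        by (auto simp: d_def lookup_single monom_0)
    qed
    then show ?thesis using kY by simp
  qed
  have evF: "poly (map_poly (\<lambda>p. poly p c) F) x
      = (\<Sum>m\<in>Poly_Mapping.keys u. ?l u m / c0 * c ^ ?l m W * x ^ (a - ?l m Y - ?l m Z))" for c x
  proof -
    interpret comm_ring_hom "\<lambda>p::'k poly. poly p c" by standard auto
    interpret mp: map_poly_comm_ring_hom "\<lambda>p::'k poly. poly p c" ..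
    show ?thesis unfolding F_def by (simp add: mp.hom_sum poly_sum map_poly_monom poly_monom)
  qed
  have evG: "poly (map_poly (\<lambda>p. poly p c) G) x
      = (\<Sum>m\<in>Poly_Mapping.keys v. ?l v m * c ^ ?l m W * x ^ (?l m W + ?l m X))" for c x
  proof -
    interpret comm_ring_hom "\<lambda>p::'k poly. poly p c" by standard auto
    interpret mp: map_poly_comm_ring_hom "\<lambda>p::'k poly. poly p c" ..
    show ?thesis unfolding G_def by (simp add: mp.hom_sum poly_sum map_poly_monom poly_monom)
  qed
  have pw: "t ^ n * t ^ j * inverse t ^ l = (t ^ 4) ^ k" if "t \<noteq> 0" "n + j = 4 * k + l" for t :: 'k and n j k l
  proof -
    have "t ^ n * t ^ j * inverse t ^ l = t ^ (4 * k) * (t ^ l * inverse t ^ l)"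
      by (simp only: power_add[symmetric] that(2) mult.assoc[symmetric])
    also have "t ^ l * inverse t ^ l = 1" using that(1) by (simp add: power_mult_distrib[symmetric])
    finally show ?thesis by (simp add: power_mult)
  qed
  show False
  proof (rule no_isolated_common_zero[OF closed dF coF dvdF coG nz(2)])
    fix c x assume Fx: "poly (map_poly (\<lambda>p. poly p c) F) x = 0" and Gx: "poly (map_poly (\<lambda>p. poly p c) G) x = 0"
    have "x \<noteq> 0"
    proof
      assume "x = 0"
      then have "poly (coeff G 0) c = 0" using Gx by (simp add: poly_0_coeff_0 coeff_map_poly)
      then show False using coG nz by simp
    qed
    \<comment> \<open>A root of T^4 - x supplies a fourth root \<open>t\<close> of \<open>x\<close>,
      the value given to \<xi>.\<close>
    have "degree [:- x, 0, 0, 0, 1:] > 0" by simp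
    then obtain t where "poly [:- x, 0, 0, 0, 1:] t = 0"
      using closed unfolding alg_closed_def by blast
    then have t: "t ^ 4 = x" by (simp add: power4_eq_xxxx mult.assoc)
    with \<open>x \<noteq> 0\<close> have "t \<noteq> 0" by auto
    have "c0 * poly (map_poly (\<lambda>p. poly p c) F) x = t ^ (3 * a) * peval id (point c t (inverse t) 1) u"
      unfolding evF peval_eq_sum sum_distrib_left
    proof (rule sum.cong[OF refl])
      fix m assume m: "m \<in> Poly_Mapping.keys u"
      have "t ^ (3 * a) * t ^ ?l m X * inverse t ^ ?l m Y = x ^ (a - ?l m Y - ?l m Z)"
        unfolding t[symmetric] by (rule pw[OF \<open>t \<noteq> 0\<close>]) (use ku[OF m] in linarith)
      then show "c0 * (?l u m / c0 * c ^ ?l m W * x ^ (a - ?l m Y - ?l m Z))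
          = t ^ (3 * a) * (?l u m * mon_eval (point c t (inverse t) 1) m)"
        using nz by (simp add: mon_eval_point_Rring[OF R(1) m] mult_ac)
    qed
    then have u0: "peval id (point c t (inverse t) 1) u = 0" using Fx \<open>t \<noteq> 0\<close> by simp
    have "poly (map_poly (\<lambda>p. poly p c) G) x = t ^ b * peval id (point c t (inverse t) 1) v"
      unfolding evG peval_eq_sum sum_distrib_left
    proof (rule sum.cong[OF refl])
      fix m assume m: "m \<in> Poly_Mapping.keys v"
      have "t ^ b * t ^ ?l m X * inverse t ^ ?l m Y = x ^ (?l m W + ?l m X)"
        unfolding t[symmetric] by (rule pw[OF \<open>t \<noteq> 0\<close>]) (simp add: kv(1)[OF m, symmetric])
      then show "?l v m * c ^ ?l m W * x ^ (?l m W + ?l m X)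
          = t ^ b * (?l v m * mon_eval (point c t (inverse t) 1) m)"
        by (simp add: mon_eval_point_Rring[OF R(2) m] mult_ac)
    qed
    then have "peval id (point c t (inverse t) 1) v = 0" using Gx \<open>t \<noteq> 0\<close> by simp
    from only[OF u0 this] show "c = 1" using \<open>t \<noteq> 0\<close> by simp
  next
    have "poly (map_poly (\<lambda>p. poly p 1) F) 1 = peval id (point 1 1 1 1) u / c0"
      unfolding evF peval_eq_sum sum_divide_distrib
      by (intro sum.cong refl) (simp add: mon_eval_point_Rring[OF R(1)])
    then show "poly (map_poly (\<lambda>p. poly p 1) F) 1 = 0" using e by simp
    have "poly (map_poly (\<lambda>p. poly p 1) G) 1 = peval id (point 1 1 1 1) v"
      unfolding evG peval_eq_sum
      by (intro sum.cong refl) (simp add: mon_eval_point_Rring[OF R(2)])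
    then show "poly (map_poly (\<lambda>p. poly p 1) G) 1 = 0" using e by simp
  qed
qed

text \<open>In the Cauchy product for degree \<open>i + j\<close> every term but one is divisible by
  \<open>p\<close>, and the exceptional one is not because \<open>p\<close> is prime. Extreme
  indices of the supports modulo \<open>p\<close> satisfy the last condition.\<close>

lemma coeff_mult_not_dvd:
  fixes A B :: "'a::comm_ring_1 poly"
  assumes prime: "\<And>u v. p dvd u * v \<Longrightarrow> p dvd u \<or> p dvd v"
    and "\<not> p dvd coeff A i" "\<not> p dvd coeff B j"
    and rest: "\<And>k l. k + l = i + j \<Longrightarrow> k \<noteq> i \<Longrightarrow> p dvd coeff A k \<or> p dvd coeff B l"
  shows "\<not> p dvd coeff (A * B) (i + j)"
proof
  assume "p dvd coeff (A * B) (i + j)"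
  also have "coeff (A * B) (i + j) = coeff A i * coeff B j + (\<Sum>k\<in>{..i + j} - {i}. coeff A k * coeff B (i + j - k))"
    unfolding coeff_mult by (subst sum.remove[of _ i]) auto
  finally have "p dvd coeff A i * coeff B j + (\<Sum>k\<in>{..i + j} - {i}. coeff A k * coeff B (i + j - k))" .
  moreover have "p dvd (\<Sum>k\<in>{..i + j} - {i}. coeff A k * coeff B (i + j - k))"
  proof (rule dvd_sum)
    fix k assume "k \<in> {..i + j} - {i}"
    then have "p dvd coeff A k \<or> p dvd coeff B (i + j - k)" by (intro rest) auto
    then show "p dvd coeff A k * coeff B (i + j - k)" by auto
  qed
  ultimately have "p dvd coeff A i * coeff B j" by (simp add: dvd_add_left_iff)
  then show False using prime assms(2,3) by blast
qed

text \<open>Modulo a homogeneous prime, a graded ring is a graded domain, and there a factor of a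
  homogeneous element is homogeneous.\<close>
lemma factor_of_monom_mod_prime:
  fixes A B :: "'a::comm_ring_1 poly"
  assumes prime: "\<And>u v. p dvd u * v \<Longrightarrow> p dvd u \<or> p dvd v"
    and AB: "\<And>k. p dvd coeff (A * B) k - coeff (monom c D) k" and c: "\<not> p dvd c"
  obtains i where "\<not> p dvd coeff B i" "\<And>k. k \<noteq> i \<Longrightarrow> p dvd coeff B k"
proof -
  \<comment> \<open>The supports of \<open>A\<close> and \<open>B\<close> modulo \<open>p\<close>;
    their largest and smallest elements play the parts of degree and order.\<close>
  define SA where "SA = {i. \<not> p dvd coeff A i}"
  define SB where "SB = {i. \<not> p dvd coeff B i}"
  have fin: "finite SA" "finite SB"
    by (rule finite_subset[of _ "{..degree A}"] finite_subset[of _ "{..degree B}"],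
        auto simp: SA_def SB_def not_le coeff_eq_0 intro: ccontr)+
  \<comment> \<open>The coefficient in degree \<open>D\<close> is \<open>c\<close> modulo
    \<open>p\<close>, so some term of its Cauchy product is not divisible by
    \<open>p\<close>.\<close>
  have "\<exists>k. p dvd c \<or> (\<not> p dvd coeff A k \<and> \<not> p dvd coeff B (D - k))"
  proof (rule ccontr)
    assume "\<not> ?thesis"
    then have "p dvd coeff A k * coeff B (D - k)" for k by (metis dvd_mult dvd_mult2)
    then have "p dvd coeff (A * B) D" unfolding coeff_mult by (intro dvd_sum)
    then have "p dvd c" using AB[of D] by (simp add: dvd_diff_right_iff)
    then show False using c by simp
  qed
  then have ne: "SA \<noteq> {}" "SB \<noteq> {}" using c by (auto simp: SA_def SB_def)
  have D: "i + j = D" if "i \<in> SA" "j \<in> SB"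
    "\<And>k l. k + l = i + j \<Longrightarrow> k \<noteq> i \<Longrightarrow> p dvd coeff A k \<or> p dvd coeff B l" for i j
  proof (rule ccontr)
    assume "i + j \<noteq> D"
    then have "p dvd coeff (A * B) (i + j)" using AB[of "i + j"] by simp
    moreover have "\<not> p dvd coeff (A * B) (i + j)"
      by (rule coeff_mult_not_dvd[OF prime]) (use that in \<open>auto simp: SA_def SB_def\<close>)
    ultimately show False by simp
  qed
  \<comment> \<open>Maxima and minima both add up to \<open>D\<close>, so each support is a single
    index.\<close>
  have "Max SA + Max SB = D"
  proof (rule D)
    fix k l assume kl: "k + l = Max SA + Max SB" "k \<noteq> Max SA"
    then have "Max SA < k \<or> Max SB < l" by linarith
    then have "k \<notin> SA \<or> l \<notin> SB" using fin Max_ge leD by blast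
    then show "p dvd coeff A k \<or> p dvd coeff B l" by (auto simp: SA_def SB_def)
  qed (use fin ne in auto)
  moreover have "Min SA + Min SB = D"
  proof (rule D)
    fix k l assume kl: "k + l = Min SA + Min SB" "k \<noteq> Min SA"
    then have "k < Min SA \<or> l < Min SB" by linarith
    then have "k \<notin> SA \<or> l \<notin> SB" using fin Min_le leD by blast
    then show "p dvd coeff A k \<or> p dvd coeff B l" by (auto simp: SA_def SB_def)
  qed (use fin ne in auto)
  moreover have "Min SA \<le> Max SA" "Min SB \<le> Max SB" using fin ne by auto
  ultimately have eq: "Min SB = Max SB" by linarith
  have "k = Max SB" if "k \<in> SB" for k
    using Min_le[OF fin(2) that] Max_ge[OF fin(2) that] eq by simp
  then have "p dvd coeff B k" if "k \<noteq> Max SB" for k using that unfolding SB_def by blast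
  moreover have "\<not> p dvd coeff B (Max SB)" using Max_in[OF fin(2) ne(2)] unfolding SB_def by blast
  ultimately show ?thesis by (rule that[rotated])
qed

text \<open>The three binomials belong to the ideal of the curve, which passes through (1,1,1,1). At
  common zeros of \<open>f\<close> and \<open>g\<close> the first one forces xy = wz, and the other
  two exclude the points [0:1:0:0] and [0:0:1:0].\<close>

lemma not_bihomogeneous:
  fixes f g :: "'k::field_char_0 mpoly"
  assumes closed: "alg_closed TYPE('k)"
    and R: "f \<in> Rring" "g \<in> Rring" and "f \<noteq> 0"
    and hom: "whom (\<lambda>_. 1) f d1" "whom (\<lambda>_. 1) g d2"
    and e: "peval id (point 1 1 1 1) f = 0" "peval id (point 1 1 1 1) g = 0"
    and q1: "(Var X * Var Y - Var W * Var Z) ^ n1 = \<alpha>1 * f + \<beta>1 * g"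
    and q2: "(Var X ^ 3 - Var W ^ 2 * Var Y) ^ n2 = \<alpha>2 * f + \<beta>2 * g"
    and q3: "(Var Y ^ 3 - Var X * Var Z ^ 2) ^ n3 = \<alpha>3 * f + \<beta>3 * g"
  shows "\<not> whom bidegw f D"
proof
  assume bihom: "whom bidegw f D"
  let ?ev = "\<lambda>w x y z. peval id (point w x y z) :: 'k mpoly \<Rightarrow> 'k"
  have evhom: "comm_ring_hom (?ev w x y z)" for w x y z by (rule comm_ring_hom_peval[OF comm_ring_hom_id])
  have evs: "?ev w x y z (p + q) = ?ev w x y z p + ?ev w x y z q"
    "?ev w x y z (p * q) = ?ev w x y z p * ?ev w x y z q"
    "?ev w x y z (p - q) = ?ev w x y z p - ?ev w x y z q"
    "?ev w x y z (p ^ n) = ?ev w x y z p ^ n"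
    "?ev w x y z (Var v) = point w x y z v" for w x y z p q n v
  proof -
    interpret comm_ring_hom "?ev w x y z" by (rule evhom)
    show "?ev w x y z (p + q) = ?ev w x y z p + ?ev w x y z q"
    "?ev w x y z (p * q) = ?ev w x y z p * ?ev w x y z q"
    "?ev w x y z (p - q) = ?ev w x y z p - ?ev w x y z q"
    "?ev w x y z (p ^ n) = ?ev w x y z p ^ n"
    "?ev w x y z (Var v) = point w x y z v"
      by (rule hom_add, rule hom_mult, rule hom_minus, rule hom_power, rule peval_Var[OF comm_ring_hom_id])
  qed
  obtain p where p: "p \<in> Rring" "p dvd f" "?ev 1 1 1 1 p = 0"
    and prime: "\<And>u v. p dvd u * v \<Longrightarrow> p dvd u \<or> p dvd v"
    using Rring_prime_factor[OF R(1) \<open>f \<noteq> 0\<close> e(1)] by blast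
  obtain f' where f': "f = p * f'" using p(2) by (rule dvdE)
  obtain a where hp1: "whom (\<lambda>_. 1) p a" using whom_factor[of _ p f'] hom(1) \<open>f \<noteq> 0\<close> f' by blast
  obtain A where hp2: "whom bidegw p A" using whom_factor[of _ p f'] bihom \<open>f \<noteq> 0\<close> f' by blast
  \<comment> \<open>A bihomogeneous non-multiple of \<open>p\<close> with a power in the ideal of
    \<open>f\<close> and \<open>g\<close>. If \<open>p\<close> divided both cubic binomials it would
    be nonzero at both coordinate points, hence a nonzero constant, contradicting its zero at
    (1,1,1,1).\<close>
  obtain q n \<alpha> \<beta> E where q: "q ^ n = \<alpha> * f + \<beta> * g" "whom bidegw q E" "\<not> p dvd q"
  proof (cases "p dvd Var X ^ 3 - Var W ^ 2 * Var Y")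
    case False
    have "graded bidegw (Var X ^ 3 - Var W ^ 2 * Var Y) = monom (Var X ^ 3 - Var W ^ 2 * Var Y :: 'k mpoly) 9"
    proof -
      interpret comm_ring_hom "graded bidegw :: 'k mpoly \<Rightarrow> _" by (rule comm_ring_hom_graded)
      show ?thesis by (simp add: hom_minus hom_mult hom_power graded_Var bidegw_def monom_power mult_monom diff_monom)
    qed
    with False q2 that show ?thesis by (auto simp: whom_iff_graded)
  next
    case True
    show ?thesis
    proof (cases "p dvd Var Y ^ 3 - Var X * Var Z ^ 2")
      case False
      have "graded bidegw (Var Y ^ 3 - Var X * Var Z ^ 2) = monom (Var Y ^ 3 - Var X * Var Z ^ 2 :: 'k mpoly) 3"
      proof -
        interpret comm_ring_hom "graded bidegw :: 'k mpoly \<Rightarrow> _" by (rule comm_ring_hom_graded)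
        show ?thesis by (simp add: hom_minus hom_mult hom_power graded_Var bidegw_def monom_power mult_monom diff_monom)
      qed
      with False q3 that show ?thesis by (auto simp: whom_iff_graded)
    next
      case True2: True
      obtain u v where "Var X ^ 3 - Var W ^ 2 * Var Y = p * u" "Var Y ^ 3 - Var X * Var Z ^ 2 = p * v"
        using True True2 by (auto elim!: dvdE)
      then have "?ev 0 1 0 0 (Var X ^ 3 - Var W ^ 2 * Var Y) = ?ev 0 1 0 0 (p * u)"
        "?ev 0 0 1 0 (Var Y ^ 3 - Var X * Var Z ^ 2) = ?ev 0 0 1 0 (p * v)" by simp_all
      then have "?ev 0 1 0 0 p \<noteq> 0" "?ev 0 0 1 0 p \<noteq> 0" by (auto simp: evs)
      then show ?thesis using bihomogeneous_nonvanishing[OF hp1 hp2] p(3) by blast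
    qed
  qed
  have np: "\<not> p dvd q ^ n"
  proof (induction n)
    case 0
    show ?case
    proof
      assume "p dvd q ^ 0"
      then obtain u where "1 = p * u" by (auto elim: dvdE)
      then have "?ev 1 1 1 1 (1 :: 'k mpoly) = ?ev 1 1 1 1 (p * u)" by simp
      also have "\<dots> = 0" using p(3) by (simp add: evs)
      finally show False using evs(4)[of 1 1 1 1 p 0] by simp
    qed
  next
    case (Suc n) then show ?case using prime[of q "q ^ n"] q(3) by auto
  qed
  interpret gr: comm_ring_hom "graded bidegw :: 'k mpoly \<Rightarrow> _" by (rule comm_ring_hom_graded)
  \<comment> \<open>Since \<open>p\<close> divides \<open>f\<close>, the graded identity for
    \<open>q ^ n\<close> becomes, modulo \<open>p\<close>, a factorisation of a single term into the
    graded images of \<open>\<beta>\<close> and \<open>g\<close>.\<close>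
  have "p dvd coeff (graded bidegw \<beta> * graded bidegw g) k - coeff (monom (q ^ n) (E * n)) k" for k
  proof -
    have "graded bidegw (q ^ n) = monom (q ^ n) (E * n)"
      using q(2) by (simp add: whom_iff_graded gr.hom_power monom_power mult.commute)
    then have eq: "graded bidegw \<alpha> * monom f D + graded bidegw \<beta> * graded bidegw g = monom (q ^ n) (E * n)"
      using bihom by (simp add: q(1) whom_iff_graded gr.hom_add gr.hom_mult)
    then have "graded bidegw \<beta> * graded bidegw g - monom (q ^ n) (E * n) = - (graded bidegw \<alpha> * monom f D)"
      by (simp add: algebra_simps flip: eq)
    then have "coeff (graded bidegw \<beta> * graded bidegw g) k - coeff (monom (q ^ n) (E * n)) k
        = coeff (- (graded bidegw \<alpha> * monom f D)) k" by (simp only: coeff_diff[symmetric])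
    moreover have "p dvd coeff (graded bidegw \<alpha> * monom f D) k"
      unfolding coeff_mult coeff_monom using p(2) by (intro dvd_sum) auto
    ultimately show ?thesis by simp
  qed
  then obtain i where i: "\<not> p dvd coeff (graded bidegw g) i"
      "\<And>k. k \<noteq> i \<Longrightarrow> p dvd coeff (graded bidegw g) k"
    using factor_of_monom_mod_prime[OF prime _ np] by blast
  \<comment> \<open>The only component of \<open>g\<close> not divisible by \<open>p\<close>; modulo
    \<open>p\<close> it can replace \<open>g\<close>.\<close>
  define v where "v = coeff (graded bidegw g) i"
  have "i \<le> degree (graded bidegw g)" using i(1) by (intro le_degree) auto
  then have "g = v + (\<Sum>k\<in>{..degree (graded bidegw g)} - {i}. coeff (graded bidegw g) k)"
    unfolding v_def by (subst sum_coeff_graded[of bidegw g, symmetric]) (simp add: sum.remove[of _ i])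
  moreover have "p dvd (\<Sum>k\<in>{..degree (graded bidegw g)} - {i}. coeff (graded bidegw g) k)"
    by (intro dvd_sum i(2)) auto
  then obtain h where "(\<Sum>k\<in>{..degree (graded bidegw g)} - {i}. coeff (graded bidegw g) k) = p * h"
    by (rule dvdE)
  ultimately have g: "g = v + p * h" by simp
  have hv2: "whom bidegw v i" unfolding v_def by (rule whom_coeff_graded)
  have hv1: "whom (\<lambda>_. 1) v d2" using hom(2) by (auto simp: whom_def v_def keys_coeff_graded)
  have vR: "v \<in> Rring" using R(2) by (auto simp: Rring_def vars_def v_def keys_coeff_graded)
  have ev: "?ev 1 1 1 1 v = 0" using e(2) p(3) by (simp add: g evs)
  have zero: "x * y = w * z \<and> x ^ 3 = w ^ 2 * y \<and> y ^ 3 = x * z ^ 2"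
    if "?ev w x y z p = 0" "?ev w x y z v = 0" for w x y z
  proof -
    have fg: "?ev w x y z f = 0" "?ev w x y z g = 0" using that by (simp_all add: f' g evs)
    have "?ev w x y z (q ^ n) = 0" if "q ^ n = \<alpha> * f + \<beta> * g" for q n \<alpha> \<beta>
      using that fg by (simp only: that evs) simp
    from this[OF q1] this[OF q2] this[OF q3] show ?thesis by (simp add: evs)
  qed
  \<comment> \<open>Neither coordinate point is a common zero of \<open>p\<close> and
    \<open>v\<close>, and neither polynomial is nonzero at both points. So one of them contains a
    pure power of x and the other a pure power of y.\<close>
  have X: "?ev 0 1 0 0 p \<noteq> 0 \<or> ?ev 0 1 0 0 v \<noteq> 0" using zero[of 0 1 0 0] by auto
  have Y: "?ev 0 0 1 0 p \<noteq> 0 \<or> ?ev 0 0 1 0 v \<noteq> 0" using zero[of 0 0 1 0] by auto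
  have np: "?ev 0 1 0 0 p = 0 \<or> ?ev 0 0 1 0 p = 0" using bihomogeneous_nonvanishing[OF hp1 hp2] p(3) by blast
  have nv: "?ev 0 1 0 0 v = 0 \<or> ?ev 0 0 1 0 v = 0" using bihomogeneous_nonvanishing[OF hv1 hv2] ev by blast
  show False
  proof (cases "?ev 0 1 0 0 p = 0")
    case True
    then have "Poly_Mapping.single X d2 \<in> Poly_Mapping.keys v" "Poly_Mapping.single Y a \<in> Poly_Mapping.keys p"
      using X Y nv X_power_in_keys[OF hv1] Y_power_in_keys[OF hp1] by blast+
    then show False using no_bihomogeneous_pair[OF closed vR p(1) hv1 hv2 hp1 hp2 _ _ ev p(3)] zero by blast
  next
    case False
    then have "Poly_Mapping.single X a \<in> Poly_Mapping.keys p" "Poly_Mapping.single Y d2 \<in> Poly_Mapping.keys v"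
      using Y np X_power_in_keys[OF hp1] Y_power_in_keys[OF hv1] by blast+
    then show False using no_bihomogeneous_pair[OF closed p(1) vR hp1 hp2 hv1 hv2 _ _ p(3) ev] zero by blast
  qed
qed

section \<open>Ideals and the curve\<close>

definition is_ideal :: "'a::comm_ring_1 set \<Rightarrow> bool" where
  "is_ideal J \<longleftrightarrow> 0 \<in> J \<and> (\<forall>x\<in>J. \<forall>y\<in>J. x + y \<in> J) \<and> (\<forall>r. \<forall>x\<in>J. r * x \<in> J)"

lemma is_ideal_sum:
  assumes "is_ideal J" "\<And>i. i \<in> A \<Longrightarrow> x i \<in> J"
  shows "(\<Sum>i\<in>A. x i) \<in> J"
  using assms(2) by (induction A rule: infinite_finite_induct) (use assms(1) in \<open>auto simp: is_ideal_def\<close>)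

lemma is_ideal_ideal_in: "is_ideal (ideal_in UNIV A)"
  unfolding is_ideal_def
proof (intro conjI ballI allI)
  show "0 \<in> ideal_in UNIV A" unfolding ideal_in_def by (auto intro!: exI[of _ "{}"])
next
  fix x y assume "x \<in> ideal_in UNIV A" "y \<in> ideal_in UNIV A"
  then obtain B c C d where B: "finite B" "B \<subseteq> A" "x = (\<Sum>a\<in>B. c a * a)"
    and C: "finite C" "C \<subseteq> A" "y = (\<Sum>a\<in>C. d a * a)" unfolding ideal_in_def by blast
  let ?e = "\<lambda>a. (if a \<in> B then c a else 0) + (if a \<in> C then d a else 0)"
  have "x = (\<Sum>a\<in>B \<union> C. (if a \<in> B then c a else 0) * a)"
    unfolding B(3) using B(1) C(1) by (intro sum.mono_neutral_cong_left) auto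
  moreover have "y = (\<Sum>a\<in>B \<union> C. (if a \<in> C then d a else 0) * a)"
    unfolding C(3) using B(1) C(1) by (intro sum.mono_neutral_cong_left) auto
  ultimately have "x + y = (\<Sum>a\<in>B \<union> C. ?e a * a)" by (simp add: sum.distrib distrib_right)
  then show "x + y \<in> ideal_in UNIV A" unfolding ideal_in_def using B C
    by (auto intro!: exI[of _ "B \<union> C"] exI[of _ ?e])
next
  fix r x assume "x \<in> ideal_in UNIV A"
  then obtain B c where B: "finite B" "B \<subseteq> A" "x = (\<Sum>a\<in>B. c a * a)" unfolding ideal_in_def by blast
  then have "r * x = (\<Sum>a\<in>B. (r * c a) * a)" by (simp add: sum_distrib_left mult.assoc)
  then show "r * x \<in> ideal_in UNIV A" unfolding ideal_in_def using B
    by (auto intro!: exI[of _ B] exI[of _ "\<lambda>a. r * c a"])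
qed

lemma ideal_in_base:
  assumes "a \<in> A"
  shows "a \<in> ideal_in UNIV A"
  unfolding ideal_in_def using assms by (auto intro!: exI[of _ "{a}"] exI[of _ "\<lambda>_. 1"])

lemma ideal_in_least:
  assumes "is_ideal J" "A \<subseteq> J"
  shows "ideal_in Rs A \<subseteq> J"
proof
  fix x assume "x \<in> ideal_in Rs A"
  then obtain B c where "B \<subseteq> A" "x = (\<Sum>a\<in>B. c a * a)" unfolding ideal_in_def by blast
  then show "x \<in> J" using assms by (auto intro!: is_ideal_sum simp: is_ideal_def subset_iff)
qed

lemma is_ideal_pair: "is_ideal {x. \<exists>\<alpha> \<beta>. x = \<alpha> * a + \<beta> * b}"
  unfolding is_ideal_def
proof (intro conjI ballI allI)
  show "0 \<in> {x. \<exists>\<alpha> \<beta>. x = \<alpha> * a + \<beta> * b}" by (auto intro!: exI[of _ 0])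
next
  fix x y assume "x \<in> {x. \<exists>\<alpha> \<beta>. x = \<alpha> * a + \<beta> * b}" "y \<in> {x. \<exists>\<alpha> \<beta>. x = \<alpha> * a + \<beta> * b}"
  then obtain p q r s where "x = p * a + q * b" "y = r * a + s * b" by blast
  then have "x + y = (p + r) * a + (q + s) * b" by (simp add: algebra_simps)
  then show "x + y \<in> {x. \<exists>\<alpha> \<beta>. x = \<alpha> * a + \<beta> * b}" by blast
next
  fix r x assume "x \<in> {x. \<exists>\<alpha> \<beta>. x = \<alpha> * a + \<beta> * b}"
  then obtain p q where "x = p * a + q * b" by blast
  then have "r * x = (r * p) * a + (r * q) * b" by (simp add: algebra_simps)
  then show "r * x \<in> {x. \<exists>\<alpha> \<beta>. x = \<alpha> * a + \<beta> * b}" by blast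
qed

text \<open>The set \<open>{a, b}\<close> may have a single element; comparison with the ideal of
  all combinations avoids that case distinction. The coefficients are only claimed to lie in the
  whole ring.\<close>

lemma ideal_in_pairD:
  assumes "x \<in> ideal_in Rs {a, b}"
  obtains \<alpha> \<beta> where "x = \<alpha> * a + \<beta> * b"
proof -
  have "a = 1 * a + 0 * b" "b = 0 * a + 1 * b" by simp_all
  then have "{a, b} \<subseteq> {x. \<exists>\<alpha> \<beta>. x = \<alpha> * a + \<beta> * b}" by blast
  from ideal_in_least[OF is_ideal_pair this] assms that show ?thesis by blast
qed

lemma ideal_in_pairI: "\<alpha> * a + \<beta> * b \<in> ideal_in UNIV {a, b}"
  using is_ideal_ideal_in[of "{a, b}"] ideal_in_base[of a "{a, b}"] ideal_in_base[of b "{a, b}"]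
  by (simp add: is_ideal_def)

lemma is_ideal_radical:
  assumes J: "is_ideal J"
  shows "is_ideal (radical_in UNIV J)"
  unfolding is_ideal_def
proof (intro conjI ballI allI)
  show "0 \<in> radical_in UNIV J" using J by (auto simp: radical_in_def is_ideal_def intro!: exI[of _ 1])
next
  fix x y assume "x \<in> radical_in UNIV J" "y \<in> radical_in UNIV J"
  then obtain m n where mn: "x ^ m \<in> J" "y ^ n \<in> J" by (auto simp: radical_in_def)
  have "(x + y) ^ (m + n) = (\<Sum>k\<le>m + n. of_nat (m + n choose k) * x ^ k * y ^ (m + n - k))"
    by (rule binomial_ring)
  also have "\<dots> \<in> J"
  proof (rule is_ideal_sum[OF J])
    fix k assume "k \<in> {..m + n}"
    show "of_nat (m + n choose k) * x ^ k * y ^ (m + n - k) \<in> J"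
    proof (cases "m \<le> k")
      case True
      then have "x ^ k = x ^ (k - m) * x ^ m" by (simp add: power_add[symmetric])
      then have "of_nat (m + n choose k) * x ^ k * y ^ (m + n - k)
          = (of_nat (m + n choose k) * x ^ (k - m) * y ^ (m + n - k)) * x ^ m" by (simp add: mult_ac)
      then show ?thesis using J mn by (simp add: is_ideal_def)
    next
      case False
      then have "y ^ (m + n - k) = y ^ (m - k) * y ^ n" by (simp add: power_add[symmetric])
      then have "of_nat (m + n choose k) * x ^ k * y ^ (m + n - k)
          = (of_nat (m + n choose k) * x ^ k * y ^ (m - k)) * y ^ n" by (simp add: mult_ac)
      then show ?thesis using J mn by (simp add: is_ideal_def)
    qed
  qed
  finally show "x + y \<in> radical_in UNIV J" by (auto simp: radical_in_def)
next
  fix r x assume "x \<in> radical_in UNIV J"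
  then obtain m where "x ^ m \<in> J" by (auto simp: radical_in_def)
  then have "(r * x) ^ m \<in> J" using J by (simp add: is_ideal_def power_mult_distrib)
  then show "r * x \<in> radical_in UNIV J" by (auto simp: radical_in_def)
qed

lemma radical_inI: "x ^ n \<in> J \<Longrightarrow> x \<in> radical_in UNIV J"
  by (auto simp: radical_in_def)

lemma radical_in_power: "x ^ n \<in> radical_in UNIV J \<Longrightarrow> x \<in> radical_in UNIV J"
  by (auto simp: radical_in_def power_mult[symmetric])

section \<open>The ideal of the curve and its extension to S\<close>

definition bidegw2 :: "var \<Rightarrow> nat" where
  "bidegw2 v = (case v of X \<Rightarrow> 1 | Y \<Rightarrow> 3 | Z \<Rightarrow> 4 | _ \<Rightarrow> 0)"

text \<open>Points of the cone over the curve, together with arbitrary values for \<lambda> and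
  \<mu>; the latter serve to describe the ideal extended to S.\<close>

definition curve :: "'k::comm_ring_1 \<Rightarrow> 'k \<Rightarrow> 'k \<Rightarrow> 'k \<Rightarrow> var \<Rightarrow> 'k" where
  "curve s t l m v = (case v of W \<Rightarrow> s ^ 4 | X \<Rightarrow> s ^ 3 * t | Y \<Rightarrow> s * t ^ 3 | Z \<Rightarrow> t ^ 4 | L \<Rightarrow> l | M \<Rightarrow> m)"

lemma wdeg_bidegw2: "wdeg bidegw2 m = Poly_Mapping.lookup m X + 3 * Poly_Mapping.lookup m Y + 4 * Poly_Mapping.lookup m Z"
  by (simp add: wdeg_def UNIV_var bidegw2_def)

lemma C4_ideal_iff: "f \<in> C4_ideal \<longleftrightarrow> f \<in> Rring \<and> (\<forall>s t. peval id (curve s t 0 0) f = 0)"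
proof -
  have "(\<lambda>v. case v of W \<Rightarrow> s ^ 4 | X \<Rightarrow> s ^ 3 * t | Y \<Rightarrow> s * t ^ 3 | Z \<Rightarrow> t ^ 4 | _ \<Rightarrow> 0) = curve s t 0 0"
    for s t :: 'a
    by (rule ext) (simp add: curve_def split: var.split)
  then show ?thesis by (simp add: C4_ideal_def)
qed

lemma peval_curve_Rring:
  assumes "f \<in> Rring"
  shows "peval id (curve s t l m) f = peval id (curve s t l' m') f"
  by (rule peval_cong) (use assms in \<open>auto simp: Rring_def curve_def\<close>)

lemma coeff_graded_Rring: "f \<in> Rring \<Longrightarrow> coeff (graded \<omega> f) i \<in> Rring"
  by (auto simp: Rring_def vars_def keys_coeff_graded)

text \<open>Rescaling \<open>s\<close> multiplies the coordinates by powers with exponents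
  \<open>bidegw\<close>, rescaling \<open>t\<close> by powers with exponents \<open>bidegw2\<close>,
  and both preserve the curve.\<close>

lemma C4_component:
  fixes f :: "'k::field_char_0 mpoly"
  assumes f: "f \<in> C4_ideal" and \<omega>: "\<omega> = bidegw \<or> \<omega> = bidegw2"
  shows "coeff (graded \<omega> f) i \<in> C4_ideal"
  unfolding C4_ideal_iff
proof (intro conjI allI)
  show "coeff (graded \<omega> f) i \<in> Rring" using f by (simp add: C4_ideal_iff coeff_graded_Rring)
  fix s t :: 'k
  show "peval id (curve s t 0 0) (coeff (graded \<omega> f) i) = 0"
  proof (rule peval_component_eq_0)
    fix c
    have "(\<lambda>v. c ^ bidegw v * curve s t 0 0 v) = curve (c * s) t 0 0"
      "(\<lambda>v. c ^ bidegw2 v * curve s t 0 0 v) = curve s (c * t) 0 0"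
      by (auto simp: fun_eq_iff curve_def bidegw_def bidegw2_def power_mult_distrib split: var.split)
    then show "peval id (\<lambda>v. c ^ \<omega> v * curve s t 0 0 v) f = 0"
      using f \<omega> by (auto simp: C4_ideal_iff)
  qed
qed

lemma mon_eval_Var_split:
  "mon_eval Var m = Var W ^ Poly_Mapping.lookup m W * Var X ^ Poly_Mapping.lookup m X
     * Var Y ^ Poly_Mapping.lookup m Y * Var Z ^ Poly_Mapping.lookup m Z
     * (Var L ^ Poly_Mapping.lookup m L * Var M ^ Poly_Mapping.lookup m M)"
  by (simp add: mon_eval_def UNIV_var mult.assoc)

lemma Rring_power: "p \<in> Rring \<Longrightarrow> p ^ n \<in> Rring" for p :: "'k::comm_ring_1 mpoly"
proof (induction n)
  case 0
  show ?case using Rring_Const[of "1 :: 'k"] by simp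
qed (simp add: Rring_mult)

lemma Rring_sum: "(\<And>i. i \<in> A \<Longrightarrow> p i \<in> Rring) \<Longrightarrow> (\<Sum>i\<in>A. p i) \<in> Rring"
  by (induction A rule: infinite_finite_induct) (auto simp: Rring_add)

lemma whom_LM_split:
  fixes h :: "'k::comm_ring_1 mpoly"
  assumes "\<And>m. m \<in> Poly_Mapping.keys h \<Longrightarrow> Poly_Mapping.lookup m L = i \<and> Poly_Mapping.lookup m M = j"
  obtains r where "r \<in> Rring" "h = Var L ^ i * Var M ^ j * r"
proof
  let ?mon = "\<lambda>m. Var W ^ Poly_Mapping.lookup m W * Var X ^ Poly_Mapping.lookup m X
     * Var Y ^ Poly_Mapping.lookup m Y * Var Z ^ Poly_Mapping.lookup m Z"
  let ?r = "\<Sum>m\<in>Poly_Mapping.keys h. Const (Poly_Mapping.lookup h m) * ?mon m"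
  show "?r \<in> Rring"
    by (intro Rring_sum Rring_mult Rring_Const Rring_power Rring_Var) auto
  have "h = (\<Sum>m\<in>Poly_Mapping.keys h. Const (Poly_Mapping.lookup h m) * mon_eval Var m)"
    by (simp only: single_eq_Const_mult[symmetric] poly_mapping_sum_single)
  also have "\<dots> = (\<Sum>m\<in>Poly_Mapping.keys h. Var L ^ i * Var M ^ j * (Const (Poly_Mapping.lookup h m) * ?mon m))"
    by (intro sum.cong refl) (simp add: mon_eval_Var_split assms mult_ac)
  finally show "h = Var L ^ i * Var M ^ j * ?r" by (simp only: sum_distrib_left)
qed

definition unit_weight :: "var \<Rightarrow> var \<Rightarrow> nat" where
  "unit_weight u v = (if v = u then 1 else 0)"

lemma wdeg_unit_weight: "wdeg (unit_weight u) m = Poly_Mapping.lookup m u"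
proof -
  have "wdeg (unit_weight u) m = (\<Sum>v\<in>UNIV. if v = u then Poly_Mapping.lookup m v else 0)"
    unfolding wdeg_def unit_weight_def by (intro sum.cong) auto
  then show ?thesis by simp
qed

text \<open>Rescaling \<lambda> and \<mu> preserves the set of points, so the components of
  \<open>h\<close> in these two variables vanish there as well. Each is a monomial in \<lambda> and
  \<mu> times an element of R, which then vanishes on the curve. In particular the extended ideal is
  radical.\<close>

lemma ideal_C4_iff:
  fixes h :: "'k::field_char_0 mpoly"
  shows "h \<in> ideal_in UNIV C4_ideal \<longleftrightarrow> (\<forall>s t l m. peval id (curve s t l m) h = 0)"
proof
  have "is_ideal {h :: 'k mpoly. \<forall>s t l m. peval id (curve s t l m) h = 0}"
    by (auto simp: is_ideal_def peval_add peval_mult comm_ring_hom_id)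
  moreover have "C4_ideal \<subseteq> {h :: 'k mpoly. \<forall>s t l m. peval id (curve s t l m) h = 0}"
  proof (clarify)
    fix f :: "'k mpoly" and s t l m assume "f \<in> C4_ideal"
    then show "peval id (curve s t l m) f = 0"
      using peval_curve_Rring[of f s t l m 0 0] by (simp only: C4_ideal_iff)
  qed
  ultimately show "h \<in> ideal_in UNIV C4_ideal \<Longrightarrow> \<forall>s t l m. peval id (curve s t l m) h = 0"
    using ideal_in_least by blast
next
  assume h: "\<forall>s t l m. peval id (curve s t l m) h = 0"
  have L: "(\<lambda>v. c ^ unit_weight L v * curve s t l m v) = curve s t (c * l) m"
    and M: "(\<lambda>v. c ^ unit_weight M v * curve s t l m v) = curve s t l (c * m)" for c s t l m :: 'k
    by (auto simp: fun_eq_iff curve_def unit_weight_def split: var.split)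
  let ?I = "ideal_in UNIV C4_ideal :: 'k mpoly set"
  have id: "is_ideal ?I" by (rule is_ideal_ideal_in)
  have comp: "coeff (graded (unit_weight M) (coeff (graded (unit_weight L) h) i)) j \<in> ?I" (is "?c \<in> _") for i j
  proof -
    have 1: "peval id (curve s t l m) (coeff (graded (unit_weight L) h) i) = 0" for s t l m
      by (rule peval_component_eq_0) (simp only: L h)
    have 2: "peval id (curve s t l m) ?c = 0" for s t l m
      by (rule peval_component_eq_0) (simp only: M 1)
    obtain r where r: "r \<in> Rring" "?c = Var L ^ i * Var M ^ j * r"
      by (rule whom_LM_split[of ?c i j]) (auto simp: keys_coeff_graded wdeg_unit_weight)
    have "peval id (curve s t 0 0) r = 0" for s t
    proof -
      \<comment> \<open>At \<lambda> = \<mu> = 1 the monomial factor is 1, leaving the value of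
        \<open>r\<close>.\<close>
      interpret comm_ring_hom "peval id (curve s t 1 1) :: 'k mpoly \<Rightarrow> 'k"
        by (rule comm_ring_hom_peval[OF comm_ring_hom_id])
      have "peval id (curve s t 1 1) (Var v) = curve s t 1 1 v" for v by (rule peval_Var[OF comm_ring_hom_id])
      then have "peval id (curve s t 1 1) r = 0" using 2[of s t 1 1]
        unfolding r(2) hom_mult hom_power by (simp add: curve_def)
      then show ?thesis using peval_curve_Rring[OF r(1), of s t 1 1 0 0] by simp
    qed
    then have "r \<in> C4_ideal" using r(1) by (simp add: C4_ideal_iff)
    then show ?thesis unfolding r(2) using id ideal_in_base[of r C4_ideal] by (simp add: is_ideal_def)
  qed
  have "coeff (graded (unit_weight L) h) i \<in> ?I" for i
    by (subst sum_coeff_graded[of "unit_weight M", symmetric]) (intro is_ideal_sum[OF id] comp)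
  then show "h \<in> ?I"
    by (subst sum_coeff_graded[of "unit_weight L", symmetric]) (intro is_ideal_sum[OF id])
qed

section \<open>The bigraded substitution and the quotients \<open>Ft\<close> and
  \<open>Gt\<close>\<close>

lemma bicomp_eq_coeff_graded: "bicomp p i = coeff (graded bidegw p) i"
  by (simp add: bicomp_def coeff_graded wdeg_bidegw)

lemma mon_eval_bisubst:
  assumes "Poly_Mapping.lookup m L = 0" "Poly_Mapping.lookup m M = 0"
  shows "mon_eval bisubst m = Var L ^ bideg1 m * Var M ^ wdeg bidegw2 m * mon_eval Var m"
  using assms
  by (simp add: mon_eval_def UNIV_var bisubst_def bideg1_def wdeg_bidegw2
      power_mult_distrib power_add power_mult[symmetric] mult_ac)

lemma peval_bisubst_Rring:
  assumes "p \<in> Rring"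
  shows "peval Const bisubst p = (\<Sum>m\<in>Poly_Mapping.keys p.
    Var L ^ bideg1 m * Var M ^ wdeg bidegw2 m * Poly_Mapping.single m (Poly_Mapping.lookup p m))"
  unfolding peval_def mon_eval_keys
  by (intro sum.cong refl)
     (simp add: mon_eval_bisubst Rring_lookup[OF assms] single_eq_Const_mult mult_ac)

lemma peval_bisubst_bihomogeneous:
  assumes "p \<in> Rring" "whom bidegw p i" "whom bidegw2 p j"
  shows "peval Const bisubst p = Var L ^ i * Var M ^ j * p"
proof -
  have "peval Const bisubst p = (\<Sum>m\<in>Poly_Mapping.keys p.
      Var L ^ i * Var M ^ j * Poly_Mapping.single m (Poly_Mapping.lookup p m))"
    unfolding peval_bisubst_Rring[OF assms(1)]
    using assms(2,3) by (intro sum.cong refl) (auto simp: whom_def wdeg_bidegw)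
  then show ?thesis by (simp only: sum_distrib_left[symmetric] poly_mapping_sum_single)
qed

lemma Var_nonzero: "(Var v :: 'k::zero_neq_one mpoly) \<noteq> 0"
proof
  assume "Var v = (0 :: 'k mpoly)"
  then have "Poly_Mapping.lookup (Var v :: 'k mpoly) (Poly_Mapping.single v 1) = 0" by simp
  then show False by (simp add: Var_def)
qed

text \<open>The two degrees of a monomial of \<open>f\<close> add up to \<open>4 * d\<close>, so the
  powers of \<lambda> and \<mu> divided out occur in every term; they cancel because S is a
  domain.\<close>

lemma bisubst_quotient:
  fixes f Ft :: "'k::field mpoly"
  assumes f: "f \<in> Rring" "homogeneous f d" "f \<noteq> 0"
    and Ft: "peval Const bisubst f = Var L ^ imin f * Var M ^ (4 * d - imax f) * Ft"
  shows "Ft = (\<Sum>m\<in>Poly_Mapping.keys f. Var L ^ (bideg1 m - imin f) * Var M ^ (imax f - bideg1 m)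
            * Poly_Mapping.single m (Poly_Mapping.lookup f m))" (is "_ = ?S")
proof -
  have ne: "Poly_Mapping.keys f \<noteq> {}" using f(3) by simp
  have b: "wdeg bidegw2 m = 4 * d - bideg1 m" "bideg1 m \<le> 4 * d" if "m \<in> Poly_Mapping.keys f" for m
  proof -
    have "mdeg m = d" using f(2) that by (simp add: homogeneous_def)
    then show "wdeg bidegw2 m = 4 * d - bideg1 m" "bideg1 m \<le> 4 * d"
      using Rring_lookup[OF f(1) that] by (auto simp: mdeg_eq bideg1_def wdeg_bidegw2)
  qed
  have mm: "imin f \<le> bideg1 m" "bideg1 m \<le> imax f" if "m \<in> Poly_Mapping.keys f" for m
    using that by (auto simp: imin_def imax_def)
  have "imax f \<le> 4 * d" unfolding imax_def using ne b(2) by (subst Max_le_iff) auto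
  have "peval Const bisubst f = Var L ^ imin f * Var M ^ (4 * d - imax f) * ?S"
    unfolding peval_bisubst_Rring[OF f(1)] sum_distrib_left
  proof (rule sum.cong[OF refl])
    fix m assume m: "m \<in> Poly_Mapping.keys f"
    have "bideg1 m = imin f + (bideg1 m - imin f)"
      "wdeg bidegw2 m = (4 * d - imax f) + (imax f - bideg1 m)"
      using mm[OF m] b[OF m] \<open>imax f \<le> 4 * d\<close> by auto
    then have "Var L ^ bideg1 m = (Var L ^ imin f * Var L ^ (bideg1 m - imin f) :: 'k mpoly)"
      "Var M ^ wdeg bidegw2 m = (Var M ^ (4 * d - imax f) * Var M ^ (imax f - bideg1 m) :: 'k mpoly)"
      by (metis power_add)+
    then show "Var L ^ bideg1 m * Var M ^ wdeg bidegw2 m * Poly_Mapping.single m (Poly_Mapping.lookup f m) =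
       Var L ^ imin f * Var M ^ (4 * d - imax f) * (Var L ^ (bideg1 m - imin f) * Var M ^ (imax f - bideg1 m)
         * Poly_Mapping.single m (Poly_Mapping.lookup f m))" by (simp only: mult_ac)
  qed
  then show ?thesis using Ft by (simp add: Var_nonzero)
qed

text \<open>Terms of least first degree carry no \<lambda>, and all share one power of \<mu>; every
  other term is a multiple of \<lambda>.\<close>

lemma bisubst_quotient_mod_L:
  fixes f :: "'k::field mpoly"
  assumes "S = (\<Sum>m\<in>Poly_Mapping.keys f. Var L ^ (bideg1 m - imin f) * Var M ^ (imax f - bideg1 m)
            * Poly_Mapping.single m (Poly_Mapping.lookup f m))"
  obtains S' where "S = Var M ^ (imax f - imin f) * bicomp f (imin f) + Var L * S'"
proof -
  let ?K = "Poly_Mapping.keys f"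
  let ?t = "\<lambda>m. Var L ^ (bideg1 m - imin f) * Var M ^ (imax f - bideg1 m)
            * Poly_Mapping.single m (Poly_Mapping.lookup f m)"
  have "S = sum ?t {m\<in>?K. bideg1 m = imin f} + sum ?t {m\<in>?K. bideg1 m \<noteq> imin f}"
    unfolding assms by (subst sum.union_disjoint[symmetric]) (auto intro: sum.cong)
  also have "sum ?t {m\<in>?K. bideg1 m = imin f} = Var M ^ (imax f - imin f) * bicomp f (imin f)"
    unfolding bicomp_def sum_distrib_left by (intro sum.cong) auto
  finally have S: "S = Var M ^ (imax f - imin f) * bicomp f (imin f) + sum ?t {m\<in>?K. bideg1 m \<noteq> imin f}" .
  have "Var L dvd sum ?t {m\<in>?K. bideg1 m \<noteq> imin f}"
  proof (rule dvd_sum)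
    fix m assume "m \<in> {m\<in>?K. bideg1 m \<noteq> imin f}"
    moreover have "imin f \<le> bideg1 m" if "m \<in> ?K" using that by (auto simp: imin_def)
    ultimately have "0 < bideg1 m - imin f" by auto
    then have "Var L dvd (Var L ^ (bideg1 m - imin f) :: 'k mpoly)" by (intro dvd_power disjI1)
    then show "Var L dvd ?t m" by (intro dvd_mult2)
  qed
  then obtain S' where "sum ?t {m\<in>?K. bideg1 m \<noteq> imin f} = Var L * S'" by (rule dvdE)
  then show ?thesis by (intro that[of S']) (simp only: S)
qed

lemma bisubst_quotient_mod_M:
  fixes f :: "'k::field mpoly"
  assumes "S = (\<Sum>m\<in>Poly_Mapping.keys f. Var L ^ (bideg1 m - imin f) * Var M ^ (imax f - bideg1 m)
            * Poly_Mapping.single m (Poly_Mapping.lookup f m))"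
  obtains S' where "S = Var L ^ (imax f - imin f) * bicomp f (imax f) + Var M * S'"
proof -
  let ?K = "Poly_Mapping.keys f"
  let ?t = "\<lambda>m. Var L ^ (bideg1 m - imin f) * Var M ^ (imax f - bideg1 m)
            * Poly_Mapping.single m (Poly_Mapping.lookup f m)"
  have "S = sum ?t {m\<in>?K. bideg1 m = imax f} + sum ?t {m\<in>?K. bideg1 m \<noteq> imax f}"
    unfolding assms by (subst sum.union_disjoint[symmetric]) (auto intro: sum.cong)
  also have "sum ?t {m\<in>?K. bideg1 m = imax f} = Var L ^ (imax f - imin f) * bicomp f (imax f)"
    unfolding bicomp_def sum_distrib_left by (intro sum.cong) auto
  finally have S: "S = Var L ^ (imax f - imin f) * bicomp f (imax f) + sum ?t {m\<in>?K. bideg1 m \<noteq> imax f}" .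
  have "Var M dvd sum ?t {m\<in>?K. bideg1 m \<noteq> imax f}"
  proof (rule dvd_sum)
    fix m assume "m \<in> {m\<in>?K. bideg1 m \<noteq> imax f}"
    moreover have "bideg1 m \<le> imax f" if "m \<in> ?K" using that by (auto simp: imax_def)
    ultimately have "0 < imax f - bideg1 m" by auto
    then have "Var M dvd (Var M ^ (imax f - bideg1 m) :: 'k mpoly)" by (intro dvd_power disjI1)
    then show "Var M dvd ?t m" by (intro dvd_mult2 dvd_mult)
  qed
  then obtain S' where "sum ?t {m\<in>?K. bideg1 m \<noteq> imax f} = Var M * S'" by (rule dvdE)
  then show ?thesis by (intro that[of S']) (simp only: S)
qed

text \<open>Grouping terms by first degree writes \<open>S\<close> as a combination of components of
  \<open>f\<close>, which lie in the ideal of the curve again.\<close>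

lemma bisubst_quotient_in_C4:
  fixes f :: "'k::field_char_0 mpoly"
  assumes f: "f \<in> C4_ideal"
    and S: "S = (\<Sum>m\<in>Poly_Mapping.keys f. Var L ^ (bideg1 m - imin f) * Var M ^ (imax f - bideg1 m)
            * Poly_Mapping.single m (Poly_Mapping.lookup f m))"
  shows "S \<in> ideal_in UNIV C4_ideal"
proof -
  let ?I = "ideal_in UNIV C4_ideal :: 'k mpoly set"
  have "S = (\<Sum>i\<in>bideg1 ` Poly_Mapping.keys f. \<Sum>m\<in>{m \<in> Poly_Mapping.keys f. bideg1 m = i}.
      Var L ^ (bideg1 m - imin f) * Var M ^ (imax f - bideg1 m) * Poly_Mapping.single m (Poly_Mapping.lookup f m))"
    unfolding S by (rule sum.image_gen) simp
  also have "\<dots> = (\<Sum>i\<in>bideg1 ` Poly_Mapping.keys f. Var L ^ (i - imin f) * Var M ^ (imax f - i) * bicomp f i)"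
    unfolding bicomp_def sum_distrib_left by (intro sum.cong refl) auto
  also have "\<dots> \<in> ?I"
  proof (rule is_ideal_sum[OF is_ideal_ideal_in])
    fix i
    have "bicomp f i \<in> ?I" unfolding bicomp_eq_coeff_graded
      by (intro ideal_in_base C4_component f) simp
    then show "Var L ^ (i - imin f) * Var M ^ (imax f - i) * bicomp f i \<in> ?I"
      using is_ideal_ideal_in[of "C4_ideal :: 'k mpoly set"] unfolding is_ideal_def by blast
  qed
  finally show ?thesis .
qed

section \<open>Reduction modulo \<lambda> or \<mu>, and saturation\<close>

definition set0 :: "var \<Rightarrow> 'k::comm_ring_1 mpoly \<Rightarrow> 'k mpoly" where
  "set0 v = peval Const (\<lambda>u. if u = v then 0 else Var u)"

lemma comm_ring_hom_set0: "comm_ring_hom (set0 v)"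
  unfolding set0_def by (rule comm_ring_hom_peval[OF comm_ring_hom_Const])

lemma set0_Var: "set0 v (Var u) = (if u = v then 0 else Var u)"
  by (simp add: set0_def comm_ring_hom_Const)

lemma set0_Rring:
  assumes "p \<in> Rring" "v \<in> {L, M}"
  shows "set0 v p = p"
proof -
  have "set0 v p = peval Const Var p" unfolding set0_def
    by (rule peval_cong) (use assms in \<open>auto simp: Rring_def\<close>)
  also have "\<dots> = p" using hom_eq_peval[OF comm_ring_hom_ident, of p] by simp
  finally show ?thesis .
qed

lemma Var_dvd_minus_set0: "Var v dvd p - set0 v p"
proof -
  have "p - set0 v p = (\<Sum>m\<in>Poly_Mapping.keys p. Const (Poly_Mapping.lookup p m) *
      (mon_eval Var m - mon_eval (\<lambda>u. if u = v then 0 else Var u) m))"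
    unfolding set0_def peval_def mon_eval_keys right_diff_distrib sum_subtractf
    by (simp only: single_eq_Const_mult[symmetric] poly_mapping_sum_single)
  also have "Var v dvd \<dots>"
    unfolding mon_eval_def by (intro dvd_sum dvd_mult prod_diff_dvd) (auto simp: power_0_left)
  finally show ?thesis .
qed

text \<open>Outside \<open>t u = 0\<close> the sequence \<open>v, F, G\<close> is regular, and since the syzygies of \<open>(F, G)\<close>
  modulo \<open>v\<close> are Koszul they lift, so \<open>v\<close> is a non-zero-divisor modulo \<open>(F, G)\<close> there.\<close>
lemma saturation_step:
  fixes a b t :: "'k::field mpoly"
  assumes vu: "v \<in> {L, M}" "u \<in> {L, M}" "v \<noteq> u"
    and R: "a \<in> Rring" "b \<in> Rring" "t \<in> Rring" and nz: "b \<noteq> 0" "t \<noteq> 0"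
    and cop: "\<forall>d\<in>Rring. dvd_in Rring d a \<longrightarrow> dvd_in Rring d b \<longrightarrow> dvd_in Rring d 1"
    and F: "F = Var u ^ e * (t * a) + Var v * F'" and G: "G = Var u ^ e' * (t * b) + Var v * G'"
    and r: "Var v * r \<in> ideal_in UNIV {F, G}"
  shows "(Var u ^ (e + e') * t) * r \<in> ideal_in UNIV {F, G}"
proof -
  interpret comm_ring_hom "set0 v :: 'k mpoly \<Rightarrow> _" by (rule comm_ring_hom_set0)
  obtain \<alpha> \<beta> where \<alpha>\<beta>: "Var v * r = \<alpha> * F + \<beta> * G" using r by (rule ideal_in_pairD)
  obtain \<alpha>1 where "\<alpha> - set0 v \<alpha> = Var v * \<alpha>1" using Var_dvd_minus_set0 by (rule dvdE)
  then have \<alpha>: "\<alpha> = set0 v \<alpha> + Var v * \<alpha>1" by (simp add: algebra_simps)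
  obtain \<beta>1 where "\<beta> - set0 v \<beta> = Var v * \<beta>1" using Var_dvd_minus_set0 by (rule dvdE)
  then have \<beta>: "\<beta> = set0 v \<beta> + Var v * \<beta>1" by (simp add: algebra_simps)
  \<comment> \<open>Reduction modulo \<open>v\<close> kills the tails \<open>F'\<close> and
    \<open>G'\<close> and leaves a syzygy between \<open>a\<close> and \<open>b\<close>, which lie
    in R and are fixed by \<open>set0\<close>.\<close>
  have "set0 v (Var v * r) = set0 v (\<alpha> * F + \<beta> * G)" using \<alpha>\<beta> by simp
  then have "0 = set0 v \<alpha> * (Var u ^ e * (t * a)) + set0 v \<beta> * (Var u ^ e' * (t * b))"
    unfolding F G using vu R by (simp add: hom_mult hom_add hom_power set0_Var set0_Rring)
  then have "t * ((set0 v \<alpha> * Var u ^ e) * a + (set0 v \<beta> * Var u ^ e') * b) = 0"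
    by (simp add: algebra_simps)
  then have syz: "(set0 v \<alpha> * Var u ^ e) * a + (set0 v \<beta> * Var u ^ e') * b = 0" using nz by simp
  then have "(set0 v \<alpha> * Var u ^ e) * a = b * (- (set0 v \<beta> * Var u ^ e'))"
    by (simp add: add_eq_0_iff2 mult.commute)
  then have "b dvd (set0 v \<alpha> * Var u ^ e) * a" by (rule dvdI)
  \<comment> \<open>Coprimality of \<open>a\<close> and \<open>b\<close> makes the syzygy a
    multiple, by \<open>\<gamma>\<close>, of the Koszul one.\<close>
  then have "b dvd set0 v \<alpha> * Var u ^ e" by (rule Rring_dvd_mult_cancel[OF R(1,2) nz(1) _ cop[rule_format]])
  then obtain \<gamma> where \<gamma>: "set0 v \<alpha> * Var u ^ e = b * \<gamma>" by (rule dvdE)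
  have "b * (\<gamma> * a + set0 v \<beta> * Var u ^ e') = 0" using syz by (simp add: \<gamma> algebra_simps)
  then have \<gamma>': "set0 v \<beta> * Var u ^ e' = - (\<gamma> * a)" using nz by (simp add: add_eq_0_iff2 add.commute)
  \<comment> \<open>The Koszul part contributes \<open>\<gamma> * (G * F - F * G) = 0\<close> up to
    the corrections \<open>Var v * G'\<close> and \<open>Var v * F'\<close>; dividing what is left
    by \<open>Var v\<close> yields these coefficients.\<close>
  let ?\<alpha> = "Var u ^ (e + e') * t * \<alpha>1 - \<gamma> * G'" and ?\<beta> = "Var u ^ (e + e') * t * \<beta>1 + \<gamma> * F'"
  have "Var v * ((Var u ^ (e + e') * t) * r) = (Var u ^ (e + e') * t) * (\<alpha> * F + \<beta> * G)"
    unfolding \<alpha>\<beta>[symmetric] by (simp only: mult_ac)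
  also have "\<dots> = (Var u ^ e' * t) * (set0 v \<alpha> * Var u ^ e) * F + (Var u ^ e * t) * (set0 v \<beta> * Var u ^ e') * G
      + Var v * (Var u ^ (e + e') * t * \<alpha>1) * F + Var v * (Var u ^ (e + e') * t * \<beta>1) * G"
    by (subst \<alpha>, subst \<beta>) (simp add: algebra_simps power_add)
  also have "\<dots> = \<gamma> * (G - Var v * G') * F - \<gamma> * (F - Var v * F') * G
      + Var v * (Var u ^ (e + e') * t * \<alpha>1) * F + Var v * (Var u ^ (e + e') * t * \<beta>1) * G"
  proof -
    have "F - Var v * F' = Var u ^ e * (t * a)" "G - Var v * G' = Var u ^ e' * (t * b)"
      using F G by simp_all
    then show ?thesis unfolding \<gamma> \<gamma>' by (simp only:) (simp add: algebra_simps)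
  qed
  also have "\<dots> = Var v * (?\<alpha> * F + ?\<beta> * G)" by (simp add: algebra_simps)
  finally have "(Var u ^ (e + e') * t) * r = ?\<alpha> * F + ?\<beta> * G" using Var_nonzero[of v] by (subst (asm) mult_cancel_left) blast
  then show ?thesis by (simp only: ideal_in_pairI)
qed

text \<open>Each use of \<open>step\<close> trades one factor \<open>x\<close> for one factor
  \<open>y\<close>.\<close>

lemma saturation:
  fixes x :: "'a::comm_ring_1"
  assumes step: "\<And>r. x * r \<in> J \<Longrightarrow> y * r \<in> J" and "x ^ k * r \<in> J"
  shows "y ^ k * r \<in> J"
  using assms(2)
proof (induction k arbitrary: r)
  case (Suc k)
  then have "x * (x ^ k * r) \<in> J" by (simp add: mult.assoc)
  then have "y * (x ^ k * r) \<in> J" by (rule step)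
  then have "x ^ k * (y * r) \<in> J" by (simp add: mult_ac)
  then have "y ^ k * (y * r) \<in> J" by (rule Suc.IH)
  then show ?case by (simp add: mult_ac)
qed simp

text \<open>A common divisor \<open>d\<close> of the cofactors makes \<open>t * d\<close> a common
  divisor of \<open>f\<close> and \<open>g\<close>; it then divides \<open>t\<close>, and cancelling
  \<open>t\<close> shows that \<open>d\<close> is a unit.\<close>

lemma gcd_cofactors:
  fixes t f g :: "'k::idom mpoly"
  assumes t: "is_gcd_in Rring t f g" and "f \<noteq> 0"
  obtains a b where "a \<in> Rring" "b \<in> Rring" "f = t * a" "g = t * b" "t \<in> Rring" "t \<noteq> 0"
    "\<forall>d\<in>Rring. dvd_in Rring d a \<longrightarrow> dvd_in Rring d b \<longrightarrow> dvd_in Rring d 1"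
proof -
  obtain a b where ab: "a \<in> Rring" "b \<in> Rring" "f = t * a" "g = t * b" and tR: "t \<in> Rring"
    using t unfolding is_gcd_in_def dvd_in_def by blast
  have "t \<noteq> 0" using ab(3) assms(2) by auto
  have "dvd_in Rring d 1" if d: "d \<in> Rring" "dvd_in Rring d a" "dvd_in Rring d b" for d
  proof -
    obtain p q where "p \<in> Rring" "q \<in> Rring" "a = d * p" "b = d * q" using d by (auto simp: dvd_in_def)
    then have "dvd_in Rring (t * d) f" "dvd_in Rring (t * d) g"
      using ab by (auto simp: dvd_in_def mult.assoc)
    then have "dvd_in Rring (t * d) t" using t Rring_mult[OF tR d(1)] unfolding is_gcd_in_def by blast
    then obtain s where s: "s \<in> Rring" "t = t * d * s" by (auto simp: dvd_in_def)
    then have "t * (d * s) = t * 1" by (simp add: mult.assoc)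
    then have "d * s = 1" using \<open>t \<noteq> 0\<close> by (subst (asm) mult_cancel_left) blast
    then show ?thesis using s(1) by (auto simp: dvd_in_def)
  qed
  then show ?thesis using that ab tR \<open>t \<noteq> 0\<close> by blast
qed

section \<open>The intersection formula for the radical\<close>

theorem theorem1:
  fixes f g :: "'k::field_char_0 mpoly" and d1 d2 :: nat
    and Ft Gt tmin tmax :: "'k mpoly"
  assumes k_closed: "alg_closed TYPE('k)"
    and fR: "f \<in> C4_ideal" and gR: "g \<in> C4_ideal"
    and f_nz: "f \<noteq> 0" and g_nz: "g \<noteq> 0"
    and f_hom: "homogeneous f d1" and g_hom: "homogeneous g d2"
    and rad: "radical_in Rring (ideal_in Rring {f, g}) = C4_ideal"
    and Ft: "peval Const bisubst f = Var L ^ imin f * Var M ^ (4 * d1 - imax f) * Ft"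
    and Gt: "peval Const bisubst g = Var L ^ imin g * Var M ^ (4 * d2 - imax g) * Gt"
    and tmin: "is_gcd_in Rring tmin (bicomp f (imin f)) (bicomp g (imin g))"
    and tmax: "is_gcd_in Rring tmax (bicomp f (imax f)) (bicomp g (imax g))"
  shows "radical_in UNIV (ideal_in UNIV {Ft, Gt}) =
           ideal_in UNIV {Var L, Var M}
           \<inter> radical_in UNIV (ideal_in UNIV {Var L, tmin})
           \<inter> radical_in UNIV (ideal_in UNIV {Var M, tmax})
           \<inter> ideal_in UNIV C4_ideal"
proof -
  let ?I = "ideal_in UNIV {Ft, Gt}"
  let ?rad = "radical_in UNIV ?I"
  have fg: "f \<in> Rring" "g \<in> Rring" using fR gR by (simp_all add: C4_ideal_iff)
  have id: "is_ideal ?rad" by (intro is_ideal_radical is_ideal_ideal_in)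
  have comb: "\<exists>n \<alpha> \<beta>. q ^ n = \<alpha> * f + \<beta> * g" if q: "q \<in> C4_ideal" for q
  proof -
    obtain n where "q ^ n \<in> ideal_in Rring {f, g}" using q unfolding rad[symmetric] radical_in_def by blast
    then show ?thesis by (elim ideal_in_pairD) blast
  qed

  \<comment> \<open>Strictness makes the power of \<mu> that is left in \<open>Ft\<close> and
    \<open>Gt\<close> modulo \<lambda> positive, which places both in the ideal of \<lambda> and
    \<mu>.\<close>
  have proper: "imin f < imax f" "imin g < imax g"
  proof -
    have q: "Var X * Var Y - Var W * Var Z \<in> (C4_ideal :: 'k mpoly set)"
      "Var X ^ 3 - Var W ^ 2 * Var Y \<in> (C4_ideal :: 'k mpoly set)"
      "Var Y ^ 3 - Var X * Var Z ^ 2 \<in> (C4_ideal :: 'k mpoly set)"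
    proof -
      have minus: "p - q \<in> Rring" if "p \<in> Rring" "q \<in> Rring" for p q :: "'k mpoly"
        using Rring_add[OF that(1) Rring_mult[OF Rring_Const[of "- 1"] that(2)]]
        by (simp add: Const_def single_uminus)
      have ev: "peval id (curve s t 0 0) (p - q) = peval id (curve s t 0 0) p - peval id (curve s t 0 0) q"
        "peval id (curve s t 0 0) (p * q) = peval id (curve s t 0 0) p * peval id (curve s t 0 0) q"
        "peval id (curve s t 0 0) (p ^ n) = peval id (curve s t 0 0) p ^ n"
        "peval id (curve s t 0 0) (Var v) = curve s t 0 0 v"
        for s t :: 'k and p q :: "'k mpoly" and n v
      proof -
        interpret comm_ring_hom "peval id (curve s t 0 0) :: 'k mpoly \<Rightarrow> 'k"
          by (rule comm_ring_hom_peval[OF comm_ring_hom_id])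
        show "peval id (curve s t 0 0) (p - q) = peval id (curve s t 0 0) p - peval id (curve s t 0 0) q"
          "peval id (curve s t 0 0) (p * q) = peval id (curve s t 0 0) p * peval id (curve s t 0 0) q"
          "peval id (curve s t 0 0) (p ^ n) = peval id (curve s t 0 0) p ^ n"
          "peval id (curve s t 0 0) (Var v) = curve s t 0 0 v"
          by (rule hom_minus, rule hom_mult, rule hom_power, rule peval_Var[OF comm_ring_hom_id])
      qed
      show "Var X * Var Y - Var W * Var Z \<in> (C4_ideal :: 'k mpoly set)"
        "Var X ^ 3 - Var W ^ 2 * Var Y \<in> (C4_ideal :: 'k mpoly set)"
        "Var Y ^ 3 - Var X * Var Z ^ 2 \<in> (C4_ideal :: 'k mpoly set)"
        unfolding C4_ideal_iff
        by (auto intro!: minus Rring_mult Rring_power Rring_Var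
            simp: ev curve_def power_mult_distrib power_mult[symmetric] power_add[symmetric]
              power2_eq_square power3_eq_cube power4_eq_xxxx)
    qed
    obtain n1 \<alpha>1 \<beta>1 where q1: "(Var X * Var Y - Var W * Var Z) ^ n1 = \<alpha>1 * f + \<beta>1 * g"
      using comb[OF q(1)] by blast
    obtain n2 \<alpha>2 \<beta>2 where q2: "(Var X ^ 3 - Var W ^ 2 * Var Y) ^ n2 = \<alpha>2 * f + \<beta>2 * g"
      using comb[OF q(2)] by blast
    obtain n3 \<alpha>3 \<beta>3 where q3: "(Var Y ^ 3 - Var X * Var Z ^ 2) ^ n3 = \<alpha>3 * f + \<beta>3 * g"
      using comb[OF q(3)] by blast
    have "curve 1 1 0 0 = (point 1 1 1 1 :: var \<Rightarrow> 'k)"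
      by (simp add: fun_eq_iff curve_def point_def split: var.split)
    then have e: "peval id (point 1 1 1 1) f = 0" "peval id (point 1 1 1 1) g = 0"
      using fR gR unfolding C4_ideal_iff by metis+
    note h = f_hom[unfolded homogeneous_iff_whom] g_hom[unfolded homogeneous_iff_whom]
    have lt: "imin p < imax p" if p: "\<not> whom bidegw p (imin p)" for p :: "'k mpoly"
    proof -
      obtain m where m: "m \<in> Poly_Mapping.keys p" "bideg1 m \<noteq> imin p"
        using p by (auto simp: whom_def wdeg_bidegw)
      then have "imin p \<le> bideg1 m" "bideg1 m \<le> imax p" by (auto simp: imin_def imax_def)
      with m show ?thesis by simp
    qed
    show "imin f < imax f"
      by (rule lt, rule not_bihomogeneous[OF k_closed fg f_nz h e q1 q2 q3])
    show "imin g < imax g"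
      by (rule lt, rule not_bihomogeneous[OF k_closed fg(2,1) g_nz h(2,1) e(2,1)])
         (rule q1[unfolded add.commute[of "_ * f"]] q2[unfolded add.commute[of "_ * f"]]
            q3[unfolded add.commute[of "_ * f"]])+
  qed

  note F = bisubst_quotient[OF fg(1) f_hom f_nz Ft]
  note G = bisubst_quotient[OF fg(2) g_hom g_nz Gt]
  obtain FL where FL: "Ft = Var M ^ (imax f - imin f) * bicomp f (imin f) + Var L * FL"
    using F by (rule bisubst_quotient_mod_L)
  obtain FM where FM: "Ft = Var L ^ (imax f - imin f) * bicomp f (imax f) + Var M * FM"
    using F by (rule bisubst_quotient_mod_M)
  obtain GL where GL: "Gt = Var M ^ (imax g - imin g) * bicomp g (imin g) + Var L * GL"
    using G by (rule bisubst_quotient_mod_L)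
  obtain GM where GM: "Gt = Var L ^ (imax g - imin g) * bicomp g (imax g) + Var M * GM"
    using G by (rule bisubst_quotient_mod_M)
  have nz: "bicomp p (imin p) \<noteq> 0" "bicomp p (imax p) \<noteq> 0" if "p \<noteq> 0" for p :: "'k mpoly"
  proof -
    have "imin p \<in> bideg1 ` Poly_Mapping.keys p" "imax p \<in> bideg1 ` Poly_Mapping.keys p"
      unfolding imin_def imax_def using that by (auto intro!: Min_in Max_in)
    moreover have "bicomp p i \<noteq> 0" if "i \<in> bideg1 ` Poly_Mapping.keys p" for i
    proof -
      from that have "Poly_Mapping.keys (bicomp p i) \<noteq> {}"
        unfolding bicomp_eq_coeff_graded keys_coeff_graded wdeg_bidegw by auto
      then show ?thesis by auto
    qed
    ultimately show "bicomp p (imin p) \<noteq> 0" "bicomp p (imax p) \<noteq> 0" by simp_all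
  qed
  obtain a b where ab: "a \<in> Rring" "b \<in> Rring" "bicomp f (imin f) = tmin * a" "bicomp g (imin g) = tmin * b"
      "tmin \<in> Rring" "tmin \<noteq> 0"
      "\<forall>d\<in>Rring. dvd_in Rring d a \<longrightarrow> dvd_in Rring d b \<longrightarrow> dvd_in Rring d 1"
    by (rule gcd_cofactors[OF tmin nz(1)[OF f_nz]])
  obtain a' b' where ab': "a' \<in> Rring" "b' \<in> Rring" "bicomp f (imax f) = tmax * a'" "bicomp g (imax g) = tmax * b'"
      "tmax \<in> Rring" "tmax \<noteq> 0"
      "\<forall>d\<in>Rring. dvd_in Rring d a' \<longrightarrow> dvd_in Rring d b' \<longrightarrow> dvd_in Rring d 1"
    by (rule gcd_cofactors[OF tmax nz(2)[OF f_nz]])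
  have b0: "b \<noteq> 0" "b' \<noteq> 0" using nz[OF g_nz] ab(4) ab'(4) by auto
  \<comment> \<open>The sum of exponents that \<open>saturation_step\<close> collects; it is the
    same for the reductions modulo \<lambda> and modulo \<mu>.\<close>
  define eM where "eM = (imax f - imin f) + (imax g - imin g)"
  have stepL: "(Var M ^ eM * tmin) * r \<in> ?I" if "Var L * r \<in> ?I" for r
    unfolding eM_def
    by (rule saturation_step[OF _ _ _ ab(1,2,5) b0(1) ab(6,7) FL[unfolded ab(3)] GL[unfolded ab(4)] that]) auto
  have stepM: "(Var L ^ eM * tmax) * r \<in> ?I" if "Var M * r \<in> ?I" for r
    unfolding eM_def
    by (rule saturation_step[OF _ _ _ ab'(1,2,5) b0(2) ab'(6,7) FM[unfolded ab'(3)] GM[unfolded ab'(4)] that]) auto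

  \<comment> \<open>The substitution turns a power of \<open>x\<close> in the ideal of
    \<open>f\<close> and \<open>g\<close> into a power of \<open>Var L ^ i * Var M ^ j * x\<close>
    in \<open>?I\<close>. Saturation then trades each \<lambda> for
    \<open>Var M ^ eM * tmin\<close>, or each \<mu> for \<open>Var L ^ eM * tmax\<close>.\<close>
  have bihom: "Var L * Var M * x \<in> ?rad \<and> Var M * tmin * x \<in> ?rad \<and> Var L * tmax * x \<in> ?rad"
    if x: "x \<in> C4_ideal" "whom bidegw x i" "whom bidegw2 x j" for x i j
  proof -
    interpret comm_ring_hom "peval Const bisubst :: 'k mpoly \<Rightarrow> _"
      by (rule comm_ring_hom_peval[OF comm_ring_hom_Const])
    obtain n \<alpha> \<beta> where "x ^ n = \<alpha> * f + \<beta> * g" using comb[OF x(1)] by blast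
    then have "peval Const bisubst x ^ n
        = peval Const bisubst \<alpha> * peval Const bisubst f + peval Const bisubst \<beta> * peval Const bisubst g"
      by (metis hom_add hom_mult hom_power)
    moreover have "peval Const bisubst x = Var L ^ i * Var M ^ j * x"
      using x by (intro peval_bisubst_bihomogeneous) (auto simp: C4_ideal_iff)
    ultimately have "(Var L ^ i * Var M ^ j * x) ^ n
      = (peval Const bisubst \<alpha> * Var L ^ imin f * Var M ^ (4 * d1 - imax f)) * Ft
       + (peval Const bisubst \<beta> * Var L ^ imin g * Var M ^ (4 * d2 - imax g)) * Gt"
      by (simp only: Ft Gt mult.assoc)
    then have mem: "(Var L ^ i * Var M ^ j * x) ^ n \<in> ?I" by (simp only: ideal_in_pairI)
    have up: "r * y \<in> ?I" if "y \<in> ?I" for r y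
      using that is_ideal_ideal_in[of "{Ft, Gt}"] by (simp add: is_ideal_def)
    have LM: "Var L ^ (i * n) * (Var M ^ (j * n) * x ^ n) \<in> ?I"
      using mem by (simp add: power_mult_distrib power_mult mult.assoc)
    \<comment> \<open>A common bound for \<open>n\<close> and all exponents arising below, so that
      each membership can be raised to one about a \<open>K\<close>-th power.\<close>
    define K where "K = (i + j + 1) * (eM + 1) * (n + 1)"
    have K: "A \<le> K" if "A \<le> (i + j + 1) * (eM + 1) * n \<or> A \<le> n" for A
    proof -
      have "(i + j + 1) * (eM + 1) * n \<le> K" "n \<le> K" unfolding K_def by (auto simp: algebra_simps)
      then show ?thesis using that by linarith
    qed
    have mono: "y ^ K * z ^ K * x ^ K \<in> ?I" if "y ^ A * z ^ B * x ^ n \<in> ?I" "A \<le> K" "B \<le> K" for A B y z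
    proof -
      have "y ^ K * z ^ K * x ^ K = (y ^ (K - A) * z ^ (K - B) * x ^ (K - n)) * (y ^ A * z ^ B * x ^ n)"
      proof -
        have "y ^ K = y ^ (K - A) * y ^ A" "z ^ K = z ^ (K - B) * z ^ B" "x ^ K = x ^ (K - n) * x ^ n"
          using that(2,3) K[of n] by (simp_all add: power_add[symmetric])
        then show ?thesis by (simp only: mult_ac)
      qed
      then show ?thesis using up[OF that(1)] by simp
    qed
    have "Var L ^ (i * n) * Var M ^ (j * n) * x ^ n \<in> ?I" using LM by (simp add: mult.assoc)
    then have "Var L ^ K * Var M ^ K * x ^ K \<in> ?I"
      by (rule mono) (rule K, simp add: algebra_simps)+
    then have 1: "Var L * Var M * x \<in> ?rad" by (intro radical_inI[of _ K]) (simp add: power_mult_distrib)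
    have "(Var M ^ eM * tmin) ^ (i * n) * (Var M ^ (j * n) * x ^ n) \<in> ?I"
      by (rule saturation[OF stepL LM])
    then have "Var M ^ (eM * (i * n) + j * n) * tmin ^ (i * n) * x ^ n \<in> ?I"
      by (simp add: power_mult_distrib power_mult[symmetric] power_add mult_ac)
    then have "Var M ^ K * tmin ^ K * x ^ K \<in> ?I"
      by (rule mono) (rule K, simp add: algebra_simps)+
    then have 2: "Var M * tmin * x \<in> ?rad" by (intro radical_inI[of _ K]) (simp add: power_mult_distrib)
    have swapped: "Var M ^ (j * n) * (Var L ^ (i * n) * x ^ n) \<in> ?I" using LM by (simp add: mult_ac)
    have "(Var L ^ eM * tmax) ^ (j * n) * (Var L ^ (i * n) * x ^ n) \<in> ?I"
      by (rule saturation[OF stepM swapped])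
    then have "Var L ^ (eM * (j * n) + i * n) * tmax ^ (j * n) * x ^ n \<in> ?I"
      by (simp add: power_mult_distrib power_mult[symmetric] power_add mult_ac)
    then have "Var L ^ K * tmax ^ K * x ^ K \<in> ?I"
      by (rule mono) (rule K, simp add: algebra_simps)+
    then have 3: "Var L * tmax * x \<in> ?rad" by (intro radical_inI[of _ K]) (simp add: power_mult_distrib)
    from 1 2 3 show ?thesis by blast
  qed
  \<comment> \<open>The elements that \<open>y\<close> multiplies into \<open>?rad\<close> form an
    ideal, and an element of \<open>C4_ideal\<close> is the sum of bihomogeneous components in
    \<open>C4_ideal\<close>; so the test on these covers the whole extended ideal.\<close>
  have colon: "y * h \<in> ?rad"
    if h: "h \<in> ideal_in UNIV C4_ideal"
      and y: "\<And>x i j. x \<in> C4_ideal \<Longrightarrow> whom bidegw x i \<Longrightarrow> whom bidegw2 x j \<Longrightarrow> y * x \<in> ?rad" for y h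
  proof -
    have "is_ideal {h. y * h \<in> ?rad}"
      using id by (auto simp: is_ideal_def distrib_left mult.left_commute)
    moreover have "C4_ideal \<subseteq> {h. y * h \<in> ?rad}"
    proof
      fix x :: "'k mpoly" assume x: "x \<in> C4_ideal"
      let ?c = "\<lambda>i. coeff (graded bidegw x) i"
      let ?d = "\<lambda>i j. coeff (graded bidegw2 (?c i)) j"
      have "y * ?d i j \<in> ?rad" for i j
      proof (rule y)
        show "?d i j \<in> C4_ideal" by (intro C4_component x) simp_all
        show "whom bidegw2 (?d i j) j" by (rule whom_coeff_graded)
        show "whom bidegw (?d i j) i" by (simp add: whom_def keys_coeff_graded)
      qed
      then have "y * ?c i \<in> ?rad" for i
        by (subst sum_coeff_graded[of bidegw2 "?c i", symmetric])
           (unfold sum_distrib_left, intro is_ideal_sum[OF id])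
      then have "y * x \<in> ?rad"
        by (subst sum_coeff_graded[of bidegw x, symmetric])
           (unfold sum_distrib_left, intro is_ideal_sum[OF id])
      then show "x \<in> {h. y * h \<in> ?rad}" by simp
    qed
    ultimately show ?thesis using ideal_in_least h by blast
  qed

  show ?thesis
  proof (intro equalityI subsetI IntI)
    fix h assume h: "h \<in> ?rad"
    then obtain n where n: "h ^ n \<in> ?I" by (auto simp: radical_in_def)
    have sub: "?I \<subseteq> J" if "is_ideal J" "Ft \<in> J" "Gt \<in> J" for J using ideal_in_least[OF that(1)] that by auto
    have pos: "Var M ^ (imax p - imin p) = Var M ^ (imax p - imin p - 1) * (Var M :: 'k mpoly)"
      if "imin p < imax p" for p :: "'k mpoly"
      using that by (metis Suc_diff_1 power_Suc2 zero_less_diff)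
    have "Ft = FL * Var L + (Var M ^ (imax f - imin f - 1) * bicomp f (imin f)) * Var M"
      unfolding FL pos[OF proper(1)] by (simp add: mult_ac)
    then have "Ft \<in> ideal_in UNIV {Var L, Var M}" by (simp only: ideal_in_pairI)
    moreover have "Gt = GL * Var L + (Var M ^ (imax g - imin g - 1) * bicomp g (imin g)) * Var M"
      unfolding GL pos[OF proper(2)] by (simp add: mult_ac)
    then have "Gt \<in> ideal_in UNIV {Var L, Var M}" by (simp only: ideal_in_pairI)
    ultimately have "h ^ n \<in> ideal_in UNIV {Var L, Var M}" using n sub[OF is_ideal_ideal_in] by blast
    then obtain \<alpha> \<beta> where hn: "h ^ n = \<alpha> * Var L + \<beta> * Var M" by (rule ideal_in_pairD)
    show "h \<in> ideal_in UNIV {Var L, Var M}"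
    proof -
      interpret L: comm_ring_hom "set0 L :: 'k mpoly \<Rightarrow> _" by (rule comm_ring_hom_set0)
      interpret M: comm_ring_hom "set0 M :: 'k mpoly \<Rightarrow> _" by (rule comm_ring_hom_set0)
      \<comment> \<open>The ideal of \<lambda> and \<mu> is radical: it is the kernel of setting
        both to zero, and S is a domain.\<close>
      have "set0 M (set0 L (h ^ n)) = 0"
        unfolding hn by (simp add: L.hom_add L.hom_mult M.hom_add M.hom_mult set0_Var)
      then have "set0 M (set0 L h) = 0" by (simp add: L.hom_power M.hom_power)
      moreover obtain p where "h - set0 L h = Var L * p" using Var_dvd_minus_set0 by (rule dvdE)
      moreover obtain q where "set0 L h - set0 M (set0 L h) = Var M * q" using Var_dvd_minus_set0 by (rule dvdE)
      ultimately have "h = p * Var L + q * Var M" by (simp add: algebra_simps)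
      then show ?thesis by (simp only: ideal_in_pairI)
    qed
    have "Ft = FL * Var L + (Var M ^ (imax f - imin f) * a) * tmin"
      by (subst FL) (simp add: ab(3) mult_ac)
    then have "Ft \<in> ideal_in UNIV {Var L, tmin}" by (simp only: ideal_in_pairI)
    moreover have "Gt = GL * Var L + (Var M ^ (imax g - imin g) * b) * tmin"
      by (subst GL) (simp add: ab(4) mult_ac)
    then have "Gt \<in> ideal_in UNIV {Var L, tmin}" by (simp only: ideal_in_pairI)
    ultimately have "h ^ n \<in> ideal_in UNIV {Var L, tmin}" using n sub[OF is_ideal_ideal_in] by blast
    then show "h \<in> radical_in UNIV (ideal_in UNIV {Var L, tmin})" by (rule radical_inI)
    have "Ft = FM * Var M + (Var L ^ (imax f - imin f) * a') * tmax"
      by (subst FM) (simp add: ab'(3) mult_ac)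
    then have "Ft \<in> ideal_in UNIV {Var M, tmax}" by (simp only: ideal_in_pairI)
    moreover have "Gt = GM * Var M + (Var L ^ (imax g - imin g) * b') * tmax"
      by (subst GM) (simp add: ab'(4) mult_ac)
    then have "Gt \<in> ideal_in UNIV {Var M, tmax}" by (simp only: ideal_in_pairI)
    ultimately have "h ^ n \<in> ideal_in UNIV {Var M, tmax}" using n sub[OF is_ideal_ideal_in] by blast
    then show "h \<in> radical_in UNIV (ideal_in UNIV {Var M, tmax})" by (rule radical_inI)
    have "h ^ n \<in> ideal_in UNIV C4_ideal"
      using n sub[OF is_ideal_ideal_in bisubst_quotient_in_C4[OF fR F] bisubst_quotient_in_C4[OF gR G]] by blast
    \<comment> \<open>By \<open>ideal_C4_iff\<close> membership means vanishing of values in a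
      field, which passes from \<open>h ^ n\<close> to \<open>h\<close>.\<close>
    then show "h \<in> ideal_in UNIV C4_ideal"
      unfolding ideal_C4_iff
    proof (intro allI)
      fix s t l m :: 'k
      interpret comm_ring_hom "peval id (curve s t l m) :: 'k mpoly \<Rightarrow> 'k"
        by (rule comm_ring_hom_peval[OF comm_ring_hom_id])
      assume "\<forall>s t l m. peval id (curve s t l m) (h ^ n) = 0"
      then have "peval id (curve s t l m) (h ^ n) = 0" by blast
      then have "peval id (curve s t l m) h ^ n = 0" unfolding hom_power .
      then show "peval id (curve s t l m) h = 0" by simp
    qed
  next
    fix h
    assume h: "h \<in> ideal_in UNIV {Var L, Var M} \<inter> radical_in UNIV (ideal_in UNIV {Var L, tmin})
           \<inter> radical_in UNIV (ideal_in UNIV {Var M, tmax}) \<inter> ideal_in UNIV C4_ideal"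
    then have p: "h \<in> ideal_in UNIV C4_ideal" by blast
    have LM: "Var L * Var M * h \<in> ?rad" and Mt: "Var M * tmin * h \<in> ?rad" and Lt: "Var L * tmax * h \<in> ?rad"
      using colon[OF p] bihom by blast+
    have cl: "r * x + s * y \<in> ?rad" if "x \<in> ?rad" "y \<in> ?rad" for r s x y
      using that id unfolding is_ideal_def by blast
    obtain n where "h ^ n \<in> ideal_in UNIV {Var L, tmin}" using h by (auto simp: radical_in_def)
    then obtain \<alpha> \<beta> where 1: "h ^ n = \<alpha> * Var L + \<beta> * tmin" by (rule ideal_in_pairD)
    \<comment> \<open>Multiplying the expression for \<open>h ^ n\<close> by
      \<open>Var M * h\<close> brings its summands into the forms covered by \<open>LM\<close> and
      \<open>Mt\<close>.\<close>
    have "Var M * h ^ (n + 1) = \<alpha> * (Var L * Var M * h) + \<beta> * (Var M * tmin * h)"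
      by (simp add: 1 algebra_simps)
    then have "Var M * h ^ (n + 1) \<in> ?rad" using cl[OF LM Mt] by simp
    obtain k where "h ^ k \<in> ideal_in UNIV {Var M, tmax}" using h by (auto simp: radical_in_def)
    then obtain \<gamma> \<delta> where 2: "h ^ k = \<gamma> * Var M + \<delta> * tmax" by (rule ideal_in_pairD)
    have "Var L * h ^ (k + 1) = \<gamma> * (Var L * Var M * h) + \<delta> * (Var L * tmax * h)"
      by (simp add: 2 algebra_simps)
    then have Lk: "Var L * h ^ (k + 1) \<in> ?rad" using cl[OF LM Lt] by simp
    obtain p q where 3: "h = p * Var L + q * Var M" using h by (auto elim: ideal_in_pairD)
    \<comment> \<open>The exponent is \<open>1 + (n + 1) + (k + 1)\<close>: the single factor
      \<open>h\<close>, written as \<open>p * Var L + q * Var M\<close>, supplies \<lambda> to one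
      power and \<mu> to the other.\<close>
    have "h ^ (n + k + 3) = h * (h ^ (n + 1) * h ^ (k + 1))"
      by (simp add: power_add power3_eq_cube mult_ac)
    also have "\<dots> = (p * Var L + q * Var M) * (h ^ (n + 1) * h ^ (k + 1))" using 3 by simp
    also have "\<dots> = (p * h ^ (n + 1)) * (Var L * h ^ (k + 1)) + (q * h ^ (k + 1)) * (Var M * h ^ (n + 1))"
      by (simp add: algebra_simps)
    also have "\<dots> \<in> ?rad" by (rule cl[OF Lk \<open>Var M * h ^ (n + 1) \<in> ?rad\<close>])
    finally show "h \<in> ?rad" by (rule radical_in_power)
  qed
qed

end
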